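(* Let $A\in\mathbb{R}^{n\times n}$ with $W(A)\subset\Sigma_{\vartheta,a}$ for some $a\ge0$ and $0\le\vartheta\le\pi/2$. Let $\ell\ge0$ be an integer, ${\bf y}(t)=\varphi_\ell(-tA){\bf v}$, ${\bf y}_{\ell,k}(t)=V_k\varphi_\ell(-tH_k)\beta{\bf e}_1$, let ${\bf e}_{\ell,k}(t)={\bf y}(t)-{\bf y}_{\ell,k}(t)$ be the error and ${\bf r}_{\ell,k}(t)$ the residual of the Arnoldi approximation ${\bf y}_{\ell,k}(t)$, and assume ${\bf e}_k^{\mathrm H}\varphi_\ell(-tH_k){\bf e}_1\ne0$. Let $\varepsilon>0$ and suppose $k+k_{1}+2\ell\geq 4$, where $k_1$ is the number of real eigenvalues of $H_k$. Then $$ \|{\bf e}_{\ell,k}(t)\|_{2}\leq c_{\ell,k}\cdot\int_{0}^{\infty}\frac{(1+\rho^{2}/\varepsilon^{2})^{-\ell/2}}{\varsigma_{k}(\rho)}\,d\rho\cdot\|{\bf r}_{\ell,k}(t)\|_{2}, $$ where $$c_{\ell,k}=\frac{\exp(t\varepsilon)}{\pi(t\varepsilon)^{\ell}\,\omega_{k}(\varepsilon)(\varepsilon+a)}\cdot\frac{\prod_{j=1}^{k-1}h_{j+1,j}}{|{\bf e}_{k}^{\mathrm{H}}\varphi_{\ell}(-tH_{k}){\bf e}_{1}|}.$$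
   Context: The $\varphi$-functions are $\varphi_0(z)=e^z$ and $\varphi_\ell(z)=\frac{1}{(\ell-1)!}\int_0^1 e^{(1-\theta)z}\theta^{\ell-1}d\theta$ for $\ell\ge1$ (extended to square matrices as matrix functions). $t>0$, and ${\bf v}\in\mathbb R^n$ is nonzero with $\beta=\|{\bf v}\|_2$. The $k$-step Arnoldi process started with ${\bf v}_1={\bf v}/\beta$ is assumed to produce $V_{k+1}=[V_k,{\bf v}_{k+1}]$ with orthonormal columns (spanning $\mathrm{span}\{{\bf v}_1,A{\bf v}_1,\dots,A^k{\bf v}_1\}$), a real $k\times k$ upper Hessenberg matrix $H_k=(h_{i,j})$ with nonnegative subdiagonal entries, and a real scalar $h_{k+1,k}$ with $AV_k=V_kH_k+h_{k+1,k}{\bf v}_{k+1}{\bf e}_k^{\mathrm{H}}$. Here ${\bf e}_j$ (single index) is the $j$-th column of the $k\times k$ identity matrix, $(\cdot)^{\mathrm{H}}$ is the conjugate transpose, ${\bf i}^2=-1$, and $'$ denotes $d/dt$. The residual is, for $\ell\ge1$, ${\bf r}_{\ell,k}(t)=-A{\bf y}_{\ell,k}(t)-\frac{\ell}{t}{\bf y}_{\ell,k}(t)+\frac{1}{t(\ell-1)!}{\bf v}-{\bf y}_{\ell,k}'(t)$, and for $\ell=0$, ${\bf r}_{0,k}(t)=-A{\bf y}_{0,k}(t)-{\bf y}_{0,k}'(t)$. $W(A)=\{(A{\bf x},{\bf x})/({\bf x},{\bf x}):{\bf 0}\ne{\bf x}\in\mathbb C^n\}$ is the numerical range, with $(\cdot,\cdot)$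 the Euclidean inner product, and $\Sigma_{\vartheta,a}=\{z\in\mathbb C:|\arg(z-a)|\le\vartheta\}$. Let $\mu_j=a_j+{\bf i}b_j$ ($j=1,\dots,k$) be the eigenvalues of $H_k$ (with multiplicity), ordered so that $\mu_1,\dots,\mu_{k_1}$ are the real ones and $\mu_{k_1+1},\dots,\mu_k$ are the non-real ones (complex conjugate pairs). Define $$r_j=\big((\varepsilon+a_j)^2+b_j^2\big)^{1/2},\qquad \omega_k(\varepsilon)=\prod_{j=1}^k\big(r_j(\varepsilon+a_j)\big)^{1/2},$$ $$\varsigma_k(\rho)=\prod_{j=1}^{k_1}(1+\rho^2/r_j^2)^{1/2}\prod_{j=k_1+1}^{k}(1+\rho^2/r_j^2)^{1/4}.$$ *)

theory Defs
  imports
    "HOL-Analysis.Analysis"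
    "Jordan_Normal_Form.Matrix"
    "Jordan_Normal_Form.Char_Poly"
    "Jordan_Normal_Form.VS_Connect"
begin

unbundle no vec_syntax
unbundle no inner_syntax
hide_type (open) Finite_Cartesian_Product.vec

text \<open>
  Vectors and matrices are those of \<open>Jordan_Normal_Form\<close>; their indices start at 0, so that
  \<open>h\<^bsub>i,j\<^esub>\<close> is \<open>H $$ (i - 1, j - 1)\<close> and \<open>e\<^sub>j\<close> is \<open>unit_vec k (j - 1)\<close>.
  The eigenvalue enumerations \<open>\<mu>\<close> below are indexed by \<open>1, ..., k\<close>.
\<close>

definition vnorm :: "real vec \<Rightarrow> real" where
  "vnorm x = sqrt (x \<bullet> x)"

text \<open>Polymorphic so that it covers both the functions on the complex plane and their
  restrictions to the real line.\<close>

definition phi :: "nat \<Rightarrow> 'a \<Rightarrow> 'a::{real_normed_field,banach}" where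
  "phi l z = (if l = 0 then exp z
     else 1 / fact (l - 1) *
       integral {0..1} (\<lambda>\<theta>::real. exp (of_real (1 - \<theta>) * z) * of_real (\<theta> ^ (l - 1))))"

text \<open>The matrix function of an entire function \<open>f\<close>, by its Taylor series at 0; the series
  converges entrywise. If the Taylor coefficients are real, as for \<open>phi\<close>, then on real
  matrices this may be computed from the restriction of \<open>f\<close> to the real line.\<close>

definition mat_fun ::
  "('a \<Rightarrow> 'a) \<Rightarrow> 'a mat \<Rightarrow> 'a::{real_normed_field,banach} mat" where
  "mat_fun f M = Matrix.mat (dim_row M) (dim_row M)
     (\<lambda>ij. \<Sum>m. (deriv ^^ m) f 0 / fact m * (M ^\<^sub>m m) $$ ij)"

definition phi_mat :: "nat \<Rightarrow> real mat \<Rightarrow> real mat" where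
  "phi_mat l M = mat_fun (phi l) M"

definition numerical_range :: "complex mat \<Rightarrow> complex set" where
  "numerical_range A =
     {((A *\<^sub>v x) \<bullet>c x) / (x \<bullet>c x) | x. x \<in> carrier_vec (dim_row A) \<and> x \<noteq> 0\<^sub>v (dim_row A)}"

text \<open>Since \<open>Arg 0 = 0\<close>, the vertex \<open>a\<close> belongs to the sector.\<close>

definition sector :: "real \<Rightarrow> real \<Rightarrow> complex set" where
  "sector \<theta> a = {z. \<bar>Arg (z - of_real a)\<bar> \<le> \<theta>}"

definition upper_hessenberg :: "'a::zero mat \<Rightarrow> bool" where
  "upper_hessenberg H \<longleftrightarrow>
     (\<forall>i < dim_row H. \<forall>j < dim_col H. Suc j < i \<longrightarrow> H $$ (i, j) = 0)"

abbreviation vspan :: "nat \<Rightarrow> real vec set \<Rightarrow> real vec set" where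
  "vspan n S \<equiv> LinearCombinations.module.span class_ring (module_vec TYPE(real) n) S"

text \<open>Outcome of \<open>k\<close> steps of the Arnoldi process for \<open>A\<close> started with \<open>v / \<parallel>v\<parallel>\<close>: \<open>V\<close> is
  \<open>V\<^sub>k\<close>, \<open>w\<close> is the vector \<open>v\<^bsub>k+1\<^esub>\<close>, and \<open>h\<close> is the scalar \<open>h\<^bsub>k+1,k\<^esub>\<close>.\<close>

definition arnoldi ::
  "nat \<Rightarrow> nat \<Rightarrow> real mat \<Rightarrow> real vec \<Rightarrow> real mat \<Rightarrow> real vec \<Rightarrow> real mat \<Rightarrow> real \<Rightarrow> bool" where
  "arnoldi n k A v V w H h \<longleftrightarrow>
     V \<in> carrier_mat n k \<and> w \<in> carrier_vec n \<and> H \<in> carrier_mat k k \<and>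
     col V 0 = (1 / vnorm v) \<cdot>\<^sub>v v \<and>
     (let W = mat_of_cols n (cols V @ [w]) in
        transpose_mat W * W = 1\<^sub>m (k + 1) \<and>
        vspan n (set (cols W)) =
          vspan n ((\<lambda>i. (A ^\<^sub>m i) *\<^sub>v ((1 / vnorm v) \<cdot>\<^sub>v v)) ` {0..k})) \<and>
     upper_hessenberg H \<and>
     (\<forall>j < k - 1. 0 \<le> H $$ (Suc j, j)) \<and>
     A * V = V * H + h \<cdot>\<^sub>m (mat_of_cols n [w] * mat_of_rows k [unit_vec k (k - 1)])"

definition exact_solution :: "nat \<Rightarrow> real mat \<Rightarrow> real vec \<Rightarrow> real \<Rightarrow> real vec" where
  "exact_solution l A v t = phi_mat l ((- t) \<cdot>\<^sub>m A) *\<^sub>v v"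

definition arnoldi_approx ::
  "nat \<Rightarrow> real mat \<Rightarrow> real mat \<Rightarrow> real vec \<Rightarrow> real \<Rightarrow> real vec" where
  "arnoldi_approx l V H v t =
     V *\<^sub>v (phi_mat l ((- t) \<cdot>\<^sub>m H) *\<^sub>v (vnorm v \<cdot>\<^sub>v unit_vec (dim_row H) 0))"

definition vec_deriv :: "(real \<Rightarrow> real vec) \<Rightarrow> real \<Rightarrow> real vec" where
  "vec_deriv y t = Matrix.vec (dim_vec (y t)) (\<lambda>i. deriv (\<lambda>s. y s $ i) t)"

definition residual ::
  "nat \<Rightarrow> real mat \<Rightarrow> real vec \<Rightarrow> (real \<Rightarrow> real vec) \<Rightarrow> real \<Rightarrow> real vec" where
  "residual l A v y t =
     (if l = 0 then - (A *\<^sub>v y t) - vec_deriv y t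
      else - (A *\<^sub>v y t) - (real l / t) \<cdot>\<^sub>v y t + (1 / (t * fact (l - 1))) \<cdot>\<^sub>v v - vec_deriv y t)"

text \<open>\<open>\<mu> 1, ..., \<mu> k\<close> are the eigenvalues of the real matrix \<open>H\<close> with algebraic multiplicity,
  of which exactly the first \<open>k1\<close> are real.\<close>

definition eigenvalue_enum :: "real mat \<Rightarrow> nat \<Rightarrow> nat \<Rightarrow> (nat \<Rightarrow> complex) \<Rightarrow> bool" where
  "eigenvalue_enum H k k1 \<mu> \<longleftrightarrow>
     char_poly (map_mat complex_of_real H) = (\<Prod>j=1..k. [:- \<mu> j, 1:]) \<and>
     k1 \<le> k \<and> (\<forall>j\<in>{1..k}. \<mu> j \<in> \<real> \<longleftrightarrow> j \<le> k1)"

definition r_eig :: "real \<Rightarrow> complex \<Rightarrow> real" where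
  "r_eig \<epsilon> z = sqrt ((\<epsilon> + Re z)\<^sup>2 + (Im z)\<^sup>2)"

definition omega :: "nat \<Rightarrow> (nat \<Rightarrow> complex) \<Rightarrow> real \<Rightarrow> real" where
  "omega k \<mu> \<epsilon> = (\<Prod>j=1..k. sqrt (r_eig \<epsilon> (\<mu> j) * (\<epsilon> + Re (\<mu> j))))"

definition varsigma :: "nat \<Rightarrow> nat \<Rightarrow> (nat \<Rightarrow> complex) \<Rightarrow> real \<Rightarrow> real \<Rightarrow> real" where
  "varsigma k k1 \<mu> \<epsilon> \<rho> =
     (\<Prod>j=1..k1. (1 + \<rho>\<^sup>2 / (r_eig \<epsilon> (\<mu> j))\<^sup>2) powr (1/2)) *
     (\<Prod>j=k1+1..k. (1 + \<rho>\<^sup>2 / (r_eig \<epsilon> (\<mu> j))\<^sup>2) powr (1/4))"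

definition bound_const ::
  "nat \<Rightarrow> nat \<Rightarrow> real mat \<Rightarrow> (nat \<Rightarrow> complex) \<Rightarrow> real \<Rightarrow> real \<Rightarrow> real \<Rightarrow> real" where
  "bound_const l k H \<mu> a \<epsilon> t =
     exp (t * \<epsilon>) / (pi * (t * \<epsilon>) ^ l * omega k \<mu> \<epsilon> * (\<epsilon> + a)) *
     ((\<Prod>j<k-1. H $$ (Suc j, j)) /
      \<bar>unit_vec k (k - 1) \<bullet> (phi_mat l ((- t) \<cdot>\<^sub>m H) *\<^sub>v unit_vec k 0)\<bar>)"

end

theory Submission
  imports
    Defs
    "HOL-Complex_Analysis.Cauchy_Integral_Formula"
    "HOL-Probability.Sinc_Integral"
    "HOL-Real_Asymp.Real_Asymp"
begin

unbundle no vec_syntax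
unbundle no inner_syntax

text \<open>
  The scaled error \<open>E(s) = s\<^sup>l e(s)\<close> solves \<open>E' = -A E + s\<^sup>l r(s)\<close> with \<open>E(0) = 0\<close>, and the Arnoldi
  relation turns the residual into \<open>s\<^sup>l r(s) = -h \<beta> g(s) w\<close>, where \<open>g(s) = s\<^sup>l e\<^sub>k\<^sup>H \<phi>\<^sub>l(-sH) e\<^sub>1\<close>. If
  \<open>|h| \<beta> |g(s)| \<le> K exp(\<epsilon>s)\<close> on \<open>[0, t]\<close>, then coercivity of \<open>A\<close> with constant \<open>a\<close> gives
  \<open>\<parallel>E(t)\<parallel> \<le> K exp(\<epsilon>t) / (\<epsilon> + a)\<close>. The function \<open>g\<close> is the inverse Laplace transform of
  \<open>\<plusminus>(\<Prod>\<^sub>j h\<^bsub>j+1,j\<^esub>) / (z\<^sup>l \<Prod>\<^sub>j (z + \<mu>\<^sub>j))\<close>, because the corner entry of the resolvent of a Hessenberg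
  matrix is a triangular minor divided by the determinant. It is first written as an integral over a
  large circle around \<open>\<epsilon>\<close>, whose right half is deformed to the line \<open>Re z = \<epsilon>\<close> and whose left half
  contributes nothing in the limit; on the line \<open>|\<Prod>\<^sub>j (z + \<mu>\<^sub>j)| \<ge> \<omega>\<^sub>k(\<epsilon>) \<varsigma>\<^sub>k(\<rho>)\<close>.
\<close>

text \<open>Large circles are used so that no inversion theorem and no conditionally convergent
  integral is needed: the Laurent series in \<open>1/z\<close> converges uniformly on them and is
  integrated term by term. With the centre at \<epsilon>, the vertical diameter lies on the line,
  and the poles \<open>0\<close> and \<open>- \<mu> j\<close> stay outside the open right
  half-plane, since the eigenvalues of \<open>H\<close> lie in the numerical range of
  \<open>A\<close>. The condition \<open>k + k1 + 2 * l \<ge> 4\<close> makes the lower bound for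
  the denominator on the line grow at least quadratically. The bound for \<open>g\<close> is uniform
  on the time interval, whereas the residual at \<open>t\<close> has norm
  \<open>|h| \<beta> |g(t)| / t^l\<close>; the unknown \<open>|h| \<beta>\<close> cancels in the
  comparison, which leaves the entry of \<open>\<phi>_l\<close> in the denominator of the
  constant.\<close>

section \<open>Exponential generating functions and matrix \<open>\<phi>\<close>-functions\<close>

text \<open>Coefficients of at most geometric growth, so that the exponential generating function is entire.\<close>

definition exp_type :: "(nat \<Rightarrow> real) \<Rightarrow> bool" where
  "exp_type d \<longleftrightarrow> (\<exists>C B. 1 \<le> B \<and> (\<forall>m. \<bar>d m\<bar> \<le> C * B ^ m))"

definition egf :: "(nat \<Rightarrow> real) \<Rightarrow> real \<Rightarrow> real" where
  "egf d t = (\<Sum>N. d N / fact N * t ^ N)"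

text \<open>Prepending \<open>l\<close> zeros integrates the generating function \<open>l\<close>
  times from 0; for \<open>c m = x ^ m\<close> its value at \<open>t\<close> is
  \<open>t ^ l * phi l (t * x)\<close>. This treats \<open>l = 0\<close> and \<open>l > 0\<close>
  alike.\<close>

definition delay :: "nat \<Rightarrow> (nat \<Rightarrow> real) \<Rightarrow> nat \<Rightarrow> real" where
  "delay l c N = (if N < l then 0 else c (N - l))"

section \<open>Closure properties of geometrically bounded sequences\<close>

lemma exp_typeI: "1 \<le> B \<Longrightarrow> (\<And>m. \<bar>d m\<bar> \<le> C * B ^ m) \<Longrightarrow> exp_type d"
  unfolding exp_type_def by blast

lemma exp_typeE:
  assumes "exp_type d"
  obtains C B where "1 \<le> B" "0 \<le> C" "\<And>m. \<bar>d m\<bar> \<le> C * B ^ m"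
proof -
  from assms obtain C B where CB: "1 \<le> B" "\<And>m. \<bar>d m\<bar> \<le> C * B ^ m"
    unfolding exp_type_def by blast
  from CB(2)[of 0] have "0 \<le> C" by simp
  with CB that show ?thesis by blast
qed

lemma exp_type_delay:
  assumes "exp_type c" shows "exp_type (delay l c)"
proof -
  obtain C B where CB: "1 \<le> B" "0 \<le> C" "\<And>m. \<bar>c m\<bar> \<le> C * B ^ m"
    by (rule exp_typeE[OF assms]) (rule that)
  have "\<bar>delay l c N\<bar> \<le> C * B ^ N" for N
  proof (cases "N < l")
    case False
    have "\<bar>c (N - l)\<bar> \<le> C * B ^ (N - l)" by (rule CB)
    also have "\<dots> \<le> C * B ^ N"
      using CB by (intro mult_left_mono power_increasing) auto
    finally show ?thesis using False by (simp add: delay_def)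
  qed (use CB in \<open>simp add: delay_def\<close>)
  with CB show ?thesis by (intro exp_typeI)
qed

lemma exp_type_Suc:
  assumes "exp_type c" shows "exp_type (\<lambda>m. c (Suc m))"
proof -
  obtain C B where CB: "1 \<le> B" "0 \<le> C" "\<And>m. \<bar>c m\<bar> \<le> C * B ^ m"
    by (rule exp_typeE[OF assms]) (rule that)
  show ?thesis
    by (rule exp_typeI[where B = B and C = "C * B"]) (use CB(1) CB(3)[of "Suc _"] in \<open>auto simp: mult_ac\<close>)
qed

lemma exp_type_cmult:
  assumes "exp_type c" shows "exp_type (\<lambda>m. x * c m)"
proof -
  obtain C B where CB: "1 \<le> B" "0 \<le> C" "\<And>m. \<bar>c m\<bar> \<le> C * B ^ m"
    by (rule exp_typeE[OF assms]) (rule that)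
  show ?thesis
    by (rule exp_typeI[where B = B and C = "\<bar>x\<bar> * C"])
       (use CB in \<open>auto simp: abs_mult mult.assoc intro: mult_left_mono\<close>)
qed

lemma exp_type_add:
  assumes "exp_type c" "exp_type d" shows "exp_type (\<lambda>m. c m + d m)"
proof -
  obtain C B where CB: "1 \<le> B" "0 \<le> C" "\<And>m. \<bar>c m\<bar> \<le> C * B ^ m"
    by (rule exp_typeE[OF assms(1)]) (rule that)
  obtain D E where DE: "1 \<le> E" "0 \<le> D" "\<And>m. \<bar>d m\<bar> \<le> D * E ^ m"
    by (rule exp_typeE[OF assms(2)]) (rule that)
  have "\<bar>c m + d m\<bar> \<le> (C + D) * (max B E) ^ m" for m
  proof -
    have "\<bar>c m + d m\<bar> \<le> C * B ^ m + D * E ^ m" using CB(3)[of m] DE(3)[of m] by linarith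
    also have "\<dots> \<le> C * max B E ^ m + D * max B E ^ m"
      using CB DE by (intro add_mono mult_left_mono power_mono) auto
    finally show ?thesis by (simp add: algebra_simps)
  qed
  thus ?thesis using CB by (intro exp_typeI[of "max B E"]) auto
qed

lemma exp_type_zero: "exp_type (\<lambda>_. 0)"
  by (rule exp_typeI[of 1 _ 0]) auto

lemma exp_type_sum:
  assumes "\<And>j. j \<in> J \<Longrightarrow> exp_type (c j)" shows "exp_type (\<lambda>m. \<Sum>j\<in>J. c j m)"
proof (cases "finite J")
  case True
  thus ?thesis using assms
    by (induction J rule: finite_induct) (auto intro: exp_type_zero exp_type_add)
qed (simp add: exp_type_zero)

lemma exp_type_power: "exp_type (\<lambda>m. x ^ m)"
  by (rule exp_typeI[of "max 1 \<bar>x\<bar>" _ 1]) (auto simp: power_abs intro: power_mono)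

section \<open>Exponential generating functions: linearity and differentiation\<close>

lemma summable_egf:
  assumes "exp_type d" shows "summable (\<lambda>N. d N / fact N * t ^ N)"
proof -
  obtain C B where CB: "1 \<le> B" "0 \<le> C" "\<And>m. \<bar>d m\<bar> \<le> C * B ^ m"
    by (rule exp_typeE[OF assms]) (rule that)
  have "summable (\<lambda>N. C * (inverse (fact N) * (B * \<bar>t\<bar>) ^ N))"
    by (intro summable_mult summable_exp)
  moreover have "norm (d N / fact N * t ^ N) \<le> C * (inverse (fact N) * (B * \<bar>t\<bar>) ^ N)" for N
  proof -
    have "norm (d N / fact N * t ^ N) = \<bar>d N\<bar> * (inverse (fact N) * \<bar>t\<bar> ^ N)"
      by (simp add: abs_mult power_abs field_simps)
    also have "\<dots> \<le> C * B ^ N * (inverse (fact N) * \<bar>t\<bar> ^ N)"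
      by (intro mult_right_mono CB) auto
    finally show ?thesis by (simp add: power_mult_distrib mult_ac)
  qed
  ultimately show ?thesis by (rule summable_comparison_test'[where N=0]) 
qed

lemma egf_sums: "exp_type d \<Longrightarrow> (\<lambda>N. d N / fact N * t ^ N) sums egf d t"
  unfolding egf_def by (rule summable_sums[OF summable_egf])

lemma egf_add:
  assumes "exp_type c" "exp_type d" shows "egf (\<lambda>m. c m + d m) t = egf c t + egf d t"
  using sums_add[OF egf_sums[OF assms(1)] egf_sums[OF assms(2)], of t t]
  unfolding egf_def by (auto simp: sums_iff algebra_simps add_divide_distrib)

lemma egf_cmult:
  assumes "exp_type c" shows "egf (\<lambda>m. x * c m) t = x * egf c t"
  using sums_mult[OF egf_sums[OF assms], of x t]
  unfolding egf_def by (auto simp: sums_iff mult_ac)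

lemma egf_zero [simp]: "egf (\<lambda>_. 0) t = 0"
  by (simp add: egf_def)

lemma egf_sum:
  assumes "\<And>j. j \<in> J \<Longrightarrow> exp_type (c j)"
  shows "egf (\<lambda>m. \<Sum>j\<in>J. c j m) t = (\<Sum>j\<in>J. egf (c j) t)"
proof (cases "finite J")
  case True
  thus ?thesis using assms
    by (induction J rule: finite_induct) (auto simp: egf_add exp_type_sum)
qed simp

lemma delay_sum: "delay l (\<lambda>m. \<Sum>j\<in>J. c j m) = (\<lambda>N. \<Sum>j\<in>J. delay l (c j) N)"
  by (auto simp: delay_def fun_eq_iff)

lemma delay_add: "delay l (\<lambda>m. c m + d m) = (\<lambda>N. delay l c N + delay l d N)"
  by (auto simp: delay_def fun_eq_iff)

lemma delay_cmult: "delay l (\<lambda>m. x * c m) = (\<lambda>N. x * delay l c N)"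
  by (auto simp: delay_def fun_eq_iff)

lemma DERIV_egf:
  assumes "exp_type d"
  shows "(egf d has_real_derivative egf (\<lambda>N. d (Suc N)) t) (at t)"
proof -
  have "diffs (\<lambda>N. d N / fact N) = (\<lambda>N. d (Suc N) / fact N)"
    by (auto simp: diffs_def fun_eq_iff simp del: of_nat_Suc)
  with termdiffs_strong_converges_everywhere[of "\<lambda>N. d N / fact N" t] summable_egf[OF assms]
  show ?thesis unfolding egf_def by simp
qed

text \<open>Differentiation shifts the delayed sequence by one place. Only \<open>c 0\<close> then
  falls outside the delayed shift of \<open>c\<close>: it lands in position \<open>l - 1\<close>.
  With \<open>c 0\<close> a component of \<open>v\<close>, this is the source term of the equation
  for \<open>t ^ l * y t\<close>.\<close>

lemma DERIV_egf_delay: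
  assumes "exp_type c"
  shows "(egf (delay l c) has_real_derivative
      (if l = 0 then 0 else c 0 * t ^ (l - 1) / fact (l - 1)) + egf (delay l (\<lambda>m. c (Suc m))) t) (at t)"
proof (cases "l = 0")
  case True
  with DERIV_egf[OF assms, of t] show ?thesis
    by (simp add: delay_def[abs_def])
next
  case False
  have eq: "(\<lambda>N. delay l c (Suc N))
      = (\<lambda>N. (if N = l - 1 then c 0 else 0) + delay l (\<lambda>m. c (Suc m)) N)"
    using False by (auto simp: delay_def fun_eq_iff Suc_diff_le)
  have sng: "(\<lambda>N. (if N = l - 1 then c 0 else 0) / fact N * t ^ N)
      sums (c 0 / fact (l - 1) * t ^ (l - 1))"
    using sums_single[of "l - 1" "\<lambda>N. c 0 / fact N * t ^ N"]
    by (rule sums_cong[THEN iffD1, rotated]) auto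
  have "exp_type (\<lambda>N. if N = l - 1 then c 0 else 0)"
    by (rule exp_typeI[of 1 _ "\<bar>c 0\<bar>"]) auto
  with eq have "egf (\<lambda>N. delay l c (Suc N)) t
      = egf (\<lambda>N. if N = l - 1 then c 0 else 0) t + egf (delay l (\<lambda>m. c (Suc m))) t"
    using assms by (simp add: egf_add exp_type_delay exp_type_Suc)
  also have "egf (\<lambda>N. if N = l - 1 then c 0 else 0) t = c 0 * t ^ (l - 1) / fact (l - 1)"
    using sng by (simp add: egf_def sums_iff)
  finally show ?thesis
    using DERIV_egf[OF exp_type_delay[OF assms], of l t] False by simp
qed

lemma egf_delay_sums:
  assumes "exp_type c"
  shows "(\<lambda>m. c m / fact (m + l) * t ^ (m + l)) sums egf (delay l c) t"
proof -
  have "(\<lambda>m. delay l c (m + l) / fact (m + l) * t ^ (m + l)) sums egf (delay l c) t"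
    using egf_sums[OF exp_type_delay[OF assms], of l t]
    by (subst sums_iff_shift) (auto simp: delay_def)
  thus ?thesis by (simp add: delay_def)
qed

section \<open>Taylor series of the scalar functions \<open>phi l\<close>\<close>

lemma phi_real_sums: "(\<lambda>m. (x::real) ^ m / fact (m + l)) sums phi l x"
proof (cases "l = 0")
  case True
  thus ?thesis using exp_converges[of x] by (simp add: phi_def field_simps)
next
  case False
  \<comment> \<open>The expected series of \<open>\<theta> ^ l * phi l (\<theta> * x)\<close>. It
    solves \<open>psi' = \<theta> ^ (l - 1) / fact (l - 1) + x * psi\<close>, so the integrating
    factor \<open>exp ((1 - \<theta>) * x)\<close> makes the integrand of \<open>phi\<close>, up to
    \<open>fact (l - 1)\<close>, an exact derivative.\<close>
  define psi where "psi = egf (delay l (\<lambda>m. x ^ m))"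
  have D: "(psi has_real_derivative (\<theta> ^ (l - 1) / fact (l - 1) + x * psi \<theta>)) (at \<theta>)" for \<theta>
    using DERIV_egf_delay[OF exp_type_power[of x], of l \<theta>] False
    by (simp add: psi_def delay_cmult egf_cmult exp_type_delay exp_type_power)
  have D': "((\<lambda>\<theta>. exp ((1 - \<theta>) * x) * psi \<theta>) has_real_derivative
      exp ((1 - \<theta>) * x) * \<theta> ^ (l - 1) / fact (l - 1)) (at \<theta>)" for \<theta>
    by (rule derivative_eq_intros D refl)+ (simp add: algebra_simps add_divide_distrib)
  have "((\<lambda>\<theta>. exp ((1 - \<theta>) * x) * \<theta> ^ (l - 1) / fact (l - 1)) has_integral
      exp ((1 - 1) * x) * psi 1 - exp ((1 - 0) * x) * psi 0) {0..1}"
    by (rule fundamental_theorem_of_calculus[OF zero_le_one])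
       (rule D'[THEN has_field_derivative_at_within, unfolded has_real_derivative_iff_has_vector_derivative])
  moreover have sm: "(\<lambda>m. x ^ m / fact (m + l)) sums psi 1"
    using egf_delay_sums[OF exp_type_power[of x], of l 1] by (simp add: psi_def)
  moreover have "psi 0 = 0"
    using sums_unique2[OF egf_delay_sums[OF exp_type_power[of x], of l 0], of 0] False
    by (simp add: psi_def power_0_left)
  ultimately have "((\<lambda>\<theta>. exp ((1 - \<theta>) * x) * \<theta> ^ (l - 1) / fact (l - 1)) has_integral psi 1) {0..1}"
    by simp
  from has_integral_mult_right[OF this, of "fact (l - 1)"]
  have "integral {0..1} (\<lambda>\<theta>. exp ((1 - \<theta>) * x) * \<theta> ^ (l - 1)) = fact (l - 1) * psi 1"
    by (intro integral_unique) (simp add: mult_ac)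
  hence "phi l x = psi 1" using False by (simp add: phi_def)
  with sm show ?thesis by simp
qed

text \<open>The derivative is again an everywhere convergent series, with coefficients
  \<open>diffs a\<close>; hence the induction generalises over \<open>a\<close> and
  \<open>f\<close>.\<close>

lemma higher_deriv_power_series_0:
  fixes a :: "nat \<Rightarrow> real"
  assumes "\<And>x. (\<lambda>m. a m * x ^ m) sums f x"
  shows "(deriv ^^ m) f 0 = fact m * a m"
  using assms
proof (induction m arbitrary: a f)
  case 0
  from 0[of 0] have "f 0 = a 0" by (simp add: sums_iff powser_zero)
  thus ?case by simp
next
  case (Suc m)
  have f: "f = (\<lambda>x. \<Sum>m. a m * x ^ m)" using Suc.prems by (auto simp: sums_iff)
  have D: "(f has_real_derivative (\<Sum>m. diffs a m * x ^ m)) (at x)" for x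
    unfolding f by (rule termdiffs_strong_converges_everywhere) (use Suc.prems in \<open>auto simp: sums_iff\<close>)
  have "(\<lambda>m. diffs a m * x ^ m) sums deriv f x" for x
    using DERIV_imp_deriv[OF D[of x]] termdiff_converges_all[of a x] Suc.prems
    by (auto simp: sums_iff)
  from Suc.IH[OF this] show ?case
    by (simp add: funpow_swap1 diffs_def)
qed

lemma higher_deriv_phi_0: "(deriv ^^ m) (phi l) (0::real) = fact m / fact (m + l)"
  using higher_deriv_power_series_0[of "\<lambda>m. 1 / fact (m + l)" "phi l" m] phi_real_sums by simp

section \<open>Matrix powers and the series of \<open>phi_mat\<close>\<close>

lemma smult_pow_mat:
  fixes N :: "'a::comm_ring_1 mat"
  assumes "N \<in> carrier_mat n n"
  shows "(t \<cdot>\<^sub>m N) ^\<^sub>m m = t ^ m \<cdot>\<^sub>m (N ^\<^sub>m m)"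
proof (induction m)
  case (Suc m)
  thus ?case using assms pow_carrier_mat[OF assms, of m]
    by (auto simp: smult_smult_assoc mult_smult_assoc_mat mult_smult_distrib mult.commute)
qed (use assms in auto)

lemma pow_mat_Suc_left:
  fixes N :: "'a::semiring_1 mat"
  assumes "N \<in> carrier_mat n n"
  shows "N ^\<^sub>m Suc m = N * N ^\<^sub>m m"
proof (induction m)
  case (Suc m)
  have "N ^\<^sub>m Suc (Suc m) = (N * N ^\<^sub>m m) * N" using Suc by simp
  also have "\<dots> = N * (N ^\<^sub>m m * N)"
    by (rule assoc_mult_mat) (use assms in auto)
  finally show ?case by simp
qed (use assms in auto)

lemma pow_mat_vec_Suc:
  fixes N :: "'a::comm_semiring_1 mat"
  assumes "N \<in> carrier_mat n n" "x \<in> carrier_vec n"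
  shows "N ^\<^sub>m Suc m *\<^sub>v x = N *\<^sub>v (N ^\<^sub>m m *\<^sub>v x)"
  unfolding pow_mat_Suc_left[OF assms(1)]
  by (rule assoc_mult_mat_vec) (use assms in \<open>auto intro: pow_carrier_mat\<close>)

lemma exp_type_pow_mat:
  fixes N :: "real mat"
  assumes N: "N \<in> carrier_mat n n" and i: "i < n" and j: "j < n"
  shows "exp_type (\<lambda>m. (N ^\<^sub>m m) $$ (i, j))"
proof -
  \<comment> \<open>The sum over all entries bounds every absolute row sum at once; the added 1
    provides the \<open>1 \<le> B\<close> required by \<open>exp_type\<close>.\<close>
  define B where "B = 1 + (\<Sum>i<n. \<Sum>j<n. \<bar>N $$ (i, j)\<bar>)"
  have B: "1 \<le> B" by (auto simp: B_def intro!: sum_nonneg)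
  have row: "(\<Sum>j<n. \<bar>N $$ (i, j)\<bar>) \<le> B" if "i < n" for i
  proof -
    have "(\<Sum>j<n. \<bar>N $$ (i, j)\<bar>) \<le> (\<Sum>i<n. \<Sum>j<n. \<bar>N $$ (i, j)\<bar>)"
      using that member_le_sum[of i "{..<n}" "\<lambda>i. \<Sum>j<n. \<bar>N $$ (i, j)\<bar>"] by (auto intro: sum_nonneg)
    thus ?thesis by (simp add: B_def)
  qed
  have "\<bar>(N ^\<^sub>m m) $$ (i, j)\<bar> \<le> 1 * B ^ m" if "i < n" for m i
    using that
  proof (induction m arbitrary: i)
    case 0
    thus ?case using N j by (auto simp: one_mat_def)
  next
    case (Suc m)
    have "(N ^\<^sub>m Suc m) $$ (i, j) = (\<Sum>p<n. N $$ (i, p) * (N ^\<^sub>m m) $$ (p, j))"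
      unfolding pow_mat_Suc_left[OF N]
      using N pow_carrier_mat[OF N, of m] Suc.prems j by (auto simp: scalar_prod_def atLeast0LessThan)
    also have "\<bar>\<dots>\<bar> \<le> (\<Sum>p<n. \<bar>N $$ (i, p)\<bar> * B ^ m)"
      using Suc.IH by (intro order.trans[OF sum_abs] sum_mono) (auto simp: abs_mult intro!: mult_left_mono)
    also have "\<dots> = (\<Sum>p<n. \<bar>N $$ (i, p)\<bar>) * B ^ m" by (simp add: sum_distrib_right)
    also have "\<dots> \<le> B * B ^ m" using row[OF Suc.prems] B by (intro mult_right_mono) auto
    finally show ?case by simp
  qed
  with i B show ?thesis by (intro exp_typeI)
qed

lemma pow_mat_vec_index:
  fixes N :: "real mat"
  assumes "N \<in> carrier_mat n n" "x \<in> carrier_vec n" "i < n"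
  shows "(N ^\<^sub>m m *\<^sub>v x) $ i = (\<Sum>j<n. x $ j * (N ^\<^sub>m m) $$ (i, j))"
  using assms pow_carrier_mat[OF assms(1), of m]
  by (auto simp: scalar_prod_def atLeast0LessThan mult.commute intro!: sum.cong)

lemma exp_type_pow_mat_vec:
  fixes N :: "real mat"
  assumes "N \<in> carrier_mat n n" "x \<in> carrier_vec n" "i < n"
  shows "exp_type (\<lambda>m. (N ^\<^sub>m m *\<^sub>v x) $ i)"
  unfolding pow_mat_vec_index[OF assms]
  using assms by (intro exp_type_sum exp_type_cmult exp_type_pow_mat) auto

lemma phi_mat_carrier: "N \<in> carrier_mat n n \<Longrightarrow> phi_mat l N \<in> carrier_mat n n"
  by (auto simp: phi_mat_def mat_fun_def)

text \<open>The factor \<open>t\<^sup>l\<close> removes the singularity of the differential equation for \<open>\<phi>\<^sub>l(tN)\<close> at \<open>t = 0\<close>.\<close>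

lemma phi_mat_index:
  assumes N: "N \<in> carrier_mat n n" and i: "i < n" and j: "j < n"
  shows "t ^ l * phi_mat l (t \<cdot>\<^sub>m N) $$ (i, j) = egf (delay l (\<lambda>m. (N ^\<^sub>m m) $$ (i, j))) t"
proof -
  have ent: "phi_mat l (t \<cdot>\<^sub>m N) $$ (i, j) = (\<Sum>m. (N ^\<^sub>m m) $$ (i, j) / fact (m + l) * t ^ m)"
    using N i j pow_carrier_mat[OF N]
    by (auto simp: phi_mat_def mat_fun_def higher_deriv_phi_0 smult_pow_mat[OF N] mult_ac divide_simps
          intro!: suminf_cong)
  have s: "(\<lambda>m. (N ^\<^sub>m m) $$ (i, j) / fact (m + l) * t ^ (m + l)) sums
      egf (delay l (\<lambda>m. (N ^\<^sub>m m) $$ (i, j))) t"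
    by (rule egf_delay_sums[OF exp_type_pow_mat[OF N i j]])
  show ?thesis
  proof (cases "t = 0")
    case False
    have "(\<lambda>m. (1 / t ^ l) * ((N ^\<^sub>m m) $$ (i, j) / fact (m + l) * t ^ (m + l))) sums
      ((1 / t ^ l) * egf (delay l (\<lambda>m. (N ^\<^sub>m m) $$ (i, j))) t)"
      by (rule sums_mult[OF s])
    with False have "phi_mat l (t \<cdot>\<^sub>m N) $$ (i, j) = (1 / t ^ l) * egf (delay l (\<lambda>m. (N ^\<^sub>m m) $$ (i, j))) t"
      unfolding ent by (simp add: sums_iff power_add)
    with False show ?thesis by simp
  next
    \<comment> \<open>Here \<open>t ^ l\<close> cannot be divided out in general; all terms with
      \<open>m > 0\<close> vanish in both series, so the two values are compared directly.\<close>
    case True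
    have "(\<lambda>m. (N ^\<^sub>m m) $$ (i, j) / fact (m + l) * t ^ m) sums ((N ^\<^sub>m 0) $$ (i, j) / fact (0 + l) * t ^ 0)"
      using True by (intro sums_finite[of "{0}", simplified]) auto
    moreover have "(\<lambda>m. (N ^\<^sub>m m) $$ (i, j) / fact (m + l) * t ^ (m + l)) sums
        ((N ^\<^sub>m 0) $$ (i, j) / fact (0 + l) * t ^ (0 + l))"
      using True sums_finite[of "{0}" "\<lambda>m. (N ^\<^sub>m m) $$ (i, j) / fact (m + l) * t ^ (m + l)"] by auto
    ultimately show ?thesis using s unfolding ent
      by (simp add: sums_iff mult.commute)
  qed
qed

lemma phi_mat_vec_index:
  assumes N: "N \<in> carrier_mat n n" and x: "x \<in> carrier_vec n" and i: "i < n"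
  shows "t ^ l * (phi_mat l (t \<cdot>\<^sub>m N) *\<^sub>v x) $ i = egf (delay l (\<lambda>m. (N ^\<^sub>m m *\<^sub>v x) $ i)) t"
proof -
  have "t ^ l * (phi_mat l (t \<cdot>\<^sub>m N) *\<^sub>v x) $ i
      = (\<Sum>j<n. x $ j * (t ^ l * phi_mat l (t \<cdot>\<^sub>m N) $$ (i, j)))"
    using N x i phi_mat_carrier[of "t \<cdot>\<^sub>m N" n l]
    by (auto simp: scalar_prod_def atLeast0LessThan mult_ac sum_distrib_left intro!: sum.cong)
  also have "\<dots> = (\<Sum>j<n. x $ j * egf (delay l (\<lambda>m. (N ^\<^sub>m m) $$ (i, j))) t)"
    using phi_mat_index[OF N i] by simp
  also have "\<dots> = egf (delay l (\<lambda>m. (N ^\<^sub>m m *\<^sub>v x) $ i)) t"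
    unfolding pow_mat_vec_index[OF N x i] delay_sum delay_cmult
    using N i by (subst egf_sum)
      (auto intro!: sum.cong egf_cmult[symmetric] exp_type_cmult exp_type_delay exp_type_pow_mat)
  finally show ?thesis .
qed

section \<open>The inverse Laplace transform along a vertical line\<close>

lemma higher_deriv_exp_cmult: "(deriv ^^ m) (\<lambda>z. exp (s * z)) = (\<lambda>z::complex. s ^ m * exp (s * z))"
proof (induction m)
  case (Suc m)
  have "((\<lambda>z. s ^ m * exp (s * z)) has_field_derivative s ^ Suc m * exp (s * z)) (at z)" for z
    by (auto intro!: derivative_eq_intros)
  thus ?case by (auto simp: Suc fun_eq_iff intro!: DERIV_imp_deriv)
qed simp

text \<open>Cauchy's formula for the \<open>k\<close>-th derivative of \<open>exp (s * z)\<close> at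
  0, a point inside the circle because \<open>norm c < R\<close>. It inverts the Laplace transform
  \<open>1 / z ^ Suc k\<close> of \<open>s ^ k / fact k\<close>.\<close>

lemma has_contour_integral_exp_over_power:
  assumes "norm c < R"
  shows "((\<lambda>z. exp (s * z) / z ^ Suc k) has_contour_integral 2 * pi * \<i> * s ^ k / fact k) (circlepath c R)"
proof -
  have "((\<lambda>z. exp (s * z) / (z - 0) ^ Suc k) has_contour_integral
      2 * pi * \<i> / fact k * (deriv ^^ k) (\<lambda>z. exp (s * z)) 0) (circlepath c R)"
    by (rule Cauchy_has_contour_integral_higher_derivative_circlepath)
       (use assms in \<open>auto intro!: continuous_intros holomorphic_intros simp: dist_norm\<close>)
  thus ?thesis by (simp add: higher_deriv_exp_cmult)
qed

text \<open>On the circle \<open>norm z\<close> is at least \<open>R - norm a\<close>, which exceeds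
  the growth rate \<open>B\<close>; so the Laurent series converges uniformly and Cauchy's formula
  applies to each term.\<close>

lemma contour_integral_exp_Laurent:
  fixes c :: "nat \<Rightarrow> real" and s :: real
  assumes B: "0 \<le> B" and C: "0 \<le> C" and c: "\<And>m. \<bar>c m\<bar> \<le> C * B ^ m" and R: "norm a + B < R"
  shows "contour_integral (circlepath a R) (\<lambda>z. \<Sum>m. of_real (c m) * (exp (of_real s * z) / z ^ Suc (m + l)))
    = 2 * pi * \<i> * of_real (egf (delay l c) s)"
proof -
  define F where "F = (\<lambda>n z. \<Sum>m<n. complex_of_real (c m) * (exp (of_real s * z) / z ^ Suc (m + l)))"
  define r where "r = R - norm a"
  have r: "B < r" "0 < r" using R B by (auto simp: r_def)
  have "norm a < R" "0 < R" using R B norm_ge_zero[of a] by linarith+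
  have F: "(F n has_contour_integral (\<Sum>m<n. of_real (c m) * (2 * pi * \<i> * of_real s ^ (m + l) / fact (m + l))))
      (circlepath a R)" for n
    unfolding F_def
    by (intro has_contour_integral_sum has_contour_integral_lmul has_contour_integral_exp_over_power \<open>norm a < R\<close>) auto
  have "uniform_limit (sphere a R) F (\<lambda>z. \<Sum>m. of_real (c m) * (exp (of_real s * z) / z ^ Suc (m + l))) sequentially"
    unfolding F_def
  proof (rule Weierstrass_m_test[where M = "\<lambda>m. C * (B / r) ^ m * (exp (\<bar>s\<bar> * (norm a + R)) / r ^ Suc l)"])
    fix m z assume "z \<in> sphere a R"
    hence z: "norm (z - a) = R" by (simp add: dist_norm norm_minus_commute)
    have zr: "r \<le> norm z" using norm_triangle_ineq4[of z a] z by (simp add: r_def)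
    have zR: "norm z \<le> norm a + R" using norm_triangle_ineq[of "z - a" a] z by simp
    have "s * Re z \<le> \<bar>s\<bar> * \<bar>Re z\<bar>"
      using abs_ge_self[of "s * Re z"] by (simp add: abs_mult)
    also have "\<dots> \<le> \<bar>s\<bar> * norm z"
      by (intro mult_left_mono abs_Re_le_cmod) simp
    also have "\<dots> \<le> \<bar>s\<bar> * (norm a + R)" using zR by (intro mult_left_mono) auto
    finally have e: "norm (exp (of_real s * z)) \<le> exp (\<bar>s\<bar> * (norm a + R))" by simp
    have p: "r ^ Suc (m + l) \<le> norm z ^ Suc (m + l)" using zr r by (intro power_mono) auto
    have "norm (of_real (c m) * (exp (of_real s * z) / z ^ Suc (m + l)))
        = \<bar>c m\<bar> * (norm (exp (of_real s * z)) / norm z ^ Suc (m + l))"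
      by (simp add: norm_mult norm_divide norm_power)
    also have "\<dots> \<le> (C * B ^ m) * (exp (\<bar>s\<bar> * (norm a + R)) / r ^ Suc (m + l))"
      using c e p r B C by (intro mult_mono frac_le) auto
    finally show "norm (of_real (c m) * (exp (of_real s * z) / z ^ Suc (m + l)))
        \<le> C * (B / r) ^ m * (exp (\<bar>s\<bar> * (norm a + R)) / r ^ Suc l)"
      by (simp add: power_divide power_add field_simps)
  next
    show "summable (\<lambda>m. C * (B / r) ^ m * (exp (\<bar>s\<bar> * (norm a + R)) / r ^ Suc l))"
      using r B by (intro summable_mult2 summable_mult summable_geometric) auto
  qed
  from contour_integral_uniform_limit_circlepath(2)[OF _ this _ \<open>0 < R\<close>]
  have "(\<lambda>n. \<Sum>m<n. of_real (c m) * (2 * pi * \<i> * of_real s ^ (m + l) / fact (m + l))) \<longlonglongrightarrow>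
      contour_integral (circlepath a R) (\<lambda>z. \<Sum>m. of_real (c m) * (exp (of_real s * z) / z ^ Suc (m + l)))"
    by (simp add: contour_integral_unique[OF F] has_contour_integral_integrable[OF F])
  hence "(\<lambda>m. of_real (c m) * (2 * pi * \<i> * of_real s ^ (m + l) / fact (m + l))) sums
      contour_integral (circlepath a R) (\<lambda>z. \<Sum>m. of_real (c m) * (exp (of_real s * z) / z ^ Suc (m + l)))"
    by (simp add: sums_def)
  moreover have "(\<lambda>m. of_real (c m) * (2 * pi * \<i> * of_real s ^ (m + l) / fact (m + l))) sums
      (2 * pi * \<i> * of_real (egf (delay l c) s))"
  proof -
    have "exp_type c"
    proof (rule exp_typeI[of "max 1 B"])
      fix m
      have "C * B ^ m \<le> C * max 1 B ^ m" using B C by (intro mult_left_mono power_mono) auto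
      with c[of m] show "\<bar>c m\<bar> \<le> C * max 1 B ^ m" by linarith
    qed simp
    from sums_mult[OF sums_of_real[OF egf_delay_sums[OF this, of l s]], where c = "2 * pi * \<i>"]
    show ?thesis by (simp add: mult_ac)
  qed
  ultimately show ?thesis by (rule sums_unique2)
qed

text \<open>On the convex half-plane \<open>f\<close> has a primitive, so the right half of the
  circle contributes as much as the segment between its end points on \<open>Re z = a\<close>. The
  left half may leave the half-plane; it is bounded by \<open>M\<close> times the arc length
  \<open>pi * R\<close>.\<close>

lemma norm_contour_integral_circle_le:
  fixes a R M :: real and f :: "complex \<Rightarrow> complex"
  assumes holf: "f holomorphic_on {z. 0 < Re z}" and contf: "continuous_on (sphere (of_real a) R) f"
    and a: "0 < a" and R: "0 < R" and M: "0 \<le> M"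
    and bnd: "\<And>z. z \<in> sphere (of_real a) R \<Longrightarrow> Re z \<le> a \<Longrightarrow> norm (f z) \<le> M"
  shows "norm (contour_integral (circlepath (of_real a) R) f)
    \<le> integral {-R..R} (\<lambda>x. norm (f (Complex a x))) + M * R * pi"
proof -
  let ?S = "{z. 0 < Re z}"
  have S: "open ?S" "convex ?S"
    by (auto simp: open_halfspace_Re_gt convex_halfspace_Re_gt)
  obtain g where g: "\<And>z. z \<in> ?S \<Longrightarrow> (g has_field_derivative f z) (at z within ?S)"
    using holomorphic_convex_primitive'[OF S(2,1) holf] by blast
  \<comment> \<open>The integrand in the angle. As \<open>circlepath\<close> starts at angle 0, the
    right half consists of two arcs, at both ends of the parameter range; cutting the integral of
    \<open>G\<close> separates them, and the primitive values at \<open>a + R\<close>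
    cancel.\<close>
  define G where "G = (\<lambda>t. f (of_real a + R * cis t) * R * \<i> * cis t)"
  have contG: "continuous_on UNIV G"
    unfolding G_def
    by (intro continuous_intros continuous_on_compose2[OF contf]) (use R in \<open>auto simp: dist_norm norm_mult\<close>)
  have intG: "G integrable_on {u..v}" for u v
    by (intro integrable_continuous_interval continuous_on_subset[OF contG]) auto
  have part: "contour_integral (part_circlepath a R u v) f = integral {u..v} G" if "u < v" for u v
    using contour_integral_part_circlepath_eq[OF that] by (simp add: G_def)
  have pint: "f contour_integrable_on part_circlepath a R u v" if "u < v" for u v
    using intG by (simp add: contour_integrable_part_circlepath_iff[OF that] G_def)
  have arc_pt: "\<exists>\<theta>\<in>{u..v}. z = of_real a + R * cis \<theta>"
    if "u \<le> v" "z \<in> path_image (part_circlepath a R u v)" for u v z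
    using that R by (auto simp: path_image_part_circlepath image_iff cis_conv_exp closed_segment_eq_real_ivl)
  have arc: "contour_integral (part_circlepath a R u v) f = g (a + R * cis v) - g (a + R * cis u)"
    if uv: "u \<le> v" and cos: "\<And>\<theta>. u \<le> \<theta> \<Longrightarrow> \<theta> \<le> v \<Longrightarrow> 0 \<le> cos \<theta>" for u v
  proof -
    have "path_image (part_circlepath a R u v) \<subseteq> ?S"
    proof
      fix z assume "z \<in> path_image (part_circlepath a R u v)"
      then obtain \<theta> where "\<theta> \<in> {u..v}" "z = of_real a + R * cis \<theta>" using arc_pt[OF uv] by blast
      thus "z \<in> ?S" using a R cos[of \<theta>] by (auto intro: add_pos_nonneg)
    qed
    from contour_integral_primitive[OF g _ this]
    have "(f has_contour_integral g (pathfinish (part_circlepath a R u v)) - g (pathstart (part_circlepath a R u v)))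
      (part_circlepath a R u v)" by simp
    from contour_integral_unique[OF this] show ?thesis by (simp add: cis_conv_exp)
  qed
  have A1: "integral {0..pi/2} G = g (a + \<i> * R) - g (a + R)"
    using arc[of 0 "pi/2"] part[of 0 "pi/2"] by (simp add: cos_ge_zero mult.commute cis_pi_half)
  have c32: "cis (pi * 3 / 2) = - \<i>" "cis (pi * 2) = 1"
    using cos_3over2_pi sin_3over2_pi by (simp_all add: complex_eq_iff mult.commute)
  have cos4: "0 \<le> cos \<theta>" if "3 * pi / 2 \<le> \<theta>" "\<theta> \<le> 2 * pi" for \<theta>
    using cos_ge_zero[of "\<theta> - 2 * pi"] that by (simp add: cos_diff)
  have A3: "integral {3*pi/2..2*pi} G = g (a + R) - g (a - \<i> * R)"
    using arc[of "3*pi/2" "2*pi"] part[of "3*pi/2" "2*pi"] cos4 by (simp add: c32 mult.commute)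
  have cosneg: "cos \<theta> \<le> 0" if "pi / 2 \<le> \<theta>" "\<theta> \<le> 3 * pi / 2" for \<theta>
    using cos_ge_zero[of "\<theta> - pi"] that by simp
  have A2: "norm (integral {pi/2..3*pi/2} G) \<le> M * R * pi"
  proof -
    have "norm (contour_integral (part_circlepath a R (pi/2) (3*pi/2)) f) \<le> M * R * \<bar>3*pi/2 - pi/2\<bar>"
    proof (rule contour_integral_bound_part_circlepath)
      fix z assume "z \<in> path_image (part_circlepath a R (pi / 2) (3 * pi / 2))"
      with arc_pt[of "pi/2" "3*pi/2" z]
      obtain \<theta> where "\<theta> \<in> {pi/2..3*pi/2}" "z = of_real a + R * cis \<theta>"
        unfolding Bex_def by fastforce
      thus "norm (f z) \<le> M" using cosneg[of \<theta>] R
        by (intro bnd) (auto simp: dist_norm norm_mult mult_nonneg_nonpos)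
    qed (use M R pint in auto)
    thus ?thesis by (simp add: part)
  qed
  have "path_image (linepath (Complex a (-R)) (Complex a R)) \<subseteq> ?S"
    using closed_segment_subset[OF _ _ S(2), of "Complex a (-R)" "Complex a R"] a by simp
  from contour_integral_primitive[OF g _ this]
  have L: "(f has_contour_integral g (Complex a R) - g (Complex a (-R)))
    (linepath (Complex a (-R)) (Complex a R))" by simp
  have "norm (g (Complex a R) - g (Complex a (-R))) = norm (integral {-R..R} (\<lambda>x. f (Complex a x)))"
    using contour_integral_linepath_same_Re[of "Complex a (-R)" a "Complex a R" "-R" R f]
      contour_integral_unique[OF L] R by (simp add: norm_mult)
  also have "\<dots> \<le> integral {-R..R} (\<lambda>x. norm (f (Complex a x)))"
  proof -
    have "continuous_on {-R..R} (\<lambda>x. f (Complex a x))"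
      by (rule continuous_on_compose2[OF holomorphic_on_imp_continuous_on[OF holf]])
         (use a in \<open>auto intro!: continuous_intros simp: Complex_eq\<close>)
    thus ?thesis
      by (intro integral_norm_bound_integral integrable_continuous_interval continuous_intros) auto
  qed
  finally have L': "norm (g (Complex a R) - g (Complex a (-R))) \<le> integral {-R..R} (\<lambda>x. norm (f (Complex a x)))" .
  have "contour_integral (circlepath a R) f = integral {0..2*pi} G"
    unfolding circlepath_def by (rule part) simp
  also have "\<dots> = integral {0..pi/2} G + integral {pi/2..2*pi} G"
    using intG by (intro Henstock_Kurzweil_Integration.integral_combine[symmetric]) auto
  also have "integral {pi/2..2*pi} G = integral {pi/2..3*pi/2} G + integral {3*pi/2..2*pi} G"
    using intG by (intro Henstock_Kurzweil_Integration.integral_combine[symmetric]) auto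
  finally have "contour_integral (circlepath a R) f
      = (g (Complex a R) - g (Complex a (-R))) + integral {pi/2..3*pi/2} G"
    using A1 A3 by (simp add: Complex_eq mult.commute)
  thus ?thesis using L' A2 norm_triangle_ineq[of "g (Complex a R) - g (Complex a (-R))" "integral {pi/2..3*pi/2} G"]
    by simp
qed

text \<open>By \<open>res\<close>, the integrand on a large circle is
  \<open>exp (s * z) * p / Q z\<close>. On the left half the exponential is at most
  \<open>exp (s * \<epsilon>)\<close> since \<open>0 \<le> s\<close>, while \<open>Q\<close> has
  degree \<open>k + l \<ge> 2\<close>, so that part vanishes as \<open>R\<close> grows. As
  \<open>J\<close> bounds all finite segments, no improper integral appears here.\<close>

lemma Bromwich_bound:
  fixes c :: "nat \<Rightarrow> real" and \<mu> :: "nat \<Rightarrow> complex" and \<epsilon> s p J :: real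
  assumes c: "exp_type c" and \<mu>: "\<And>j. j \<in> {1..k} \<Longrightarrow> 0 \<le> Re (\<mu> j)" and \<epsilon>: "0 < \<epsilon>" and s: "0 \<le> s"
    and kl: "2 \<le> k + l"
    and res: "\<And>z. r0 < norm z \<Longrightarrow> (\<Sum>m. of_real (c m) / z ^ Suc m) * (\<Prod>j=1..k. z + \<mu> j) = of_real p"
    and J: "\<And>R. 0 < R \<Longrightarrow> integral {-R..R} (\<lambda>x. 1 / norm (Complex \<epsilon> x ^ l * (\<Prod>j=1..k. Complex \<epsilon> x + \<mu> j))) \<le> J"
  shows "2 * pi * \<bar>egf (delay l c) s\<bar> \<le> exp (s * \<epsilon>) * \<bar>p\<bar> * J"
proof -
  obtain C B where CB: "1 \<le> B" "0 \<le> C" "\<And>m. \<bar>c m\<bar> \<le> C * B ^ m"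
    by (rule exp_typeE[OF c]) (rule that)
  \<comment> \<open>No zero of \<open>Q\<close>, neither 0 nor any \<open>- \<mu> j\<close>, is
    farther than \<open>D\<close> from the centre \<epsilon>; so on the circle every linear factor
    has modulus at least \<open>R - D\<close>.\<close>
  define D where "D = \<epsilon> + (\<Sum>j=1..k. norm (of_real \<epsilon> + \<mu> j))"
  define Q where "Q = (\<lambda>z. z ^ l * (\<Prod>j=1..k. z + \<mu> j))"
  define f where "f = (\<lambda>z. exp (of_real s * z) * of_real p / Q z)"
  have D: "\<epsilon> \<le> D" "\<And>j. j \<in> {1..k} \<Longrightarrow> norm (of_real \<epsilon> + \<mu> j) \<le> D"
  proof -
    show "\<epsilon> \<le> D" by (auto simp: D_def intro!: sum_nonneg)
    fix j assume "j \<in> {1..k}"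
    hence "norm (of_real \<epsilon> + \<mu> j) \<le> (\<Sum>j=1..k. norm (of_real \<epsilon> + \<mu> j))"
      by (intro member_le_sum) auto
    thus "norm (of_real \<epsilon> + \<mu> j) \<le> D" using \<epsilon> by (simp add: D_def)
  qed
  have Qlow: "(R - D) ^ (k + l) \<le> norm (Q z)" if "z \<in> sphere (of_real \<epsilon>) R" "D \<le> R" for z R
  proof -
    have z: "norm (z - of_real \<epsilon>) = R" using that by (simp add: dist_norm norm_minus_commute)
    have 1: "R - D \<le> norm z"
      using norm_triangle_ineq4[of z "of_real \<epsilon>"] z D(1) \<epsilon> by simp
    have 2: "R - D \<le> norm (z + \<mu> j)" if "j \<in> {1..k}" for j
      using norm_triangle_ineq4[of "z + \<mu> j" "of_real \<epsilon> + \<mu> j"] z D(2)[OF that] by simp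
    have "(R - D) ^ (k + l) = (R - D) ^ l * (\<Prod>j=1..k. R - D)" by (simp add: power_add)
    also have "\<dots> \<le> norm z ^ l * (\<Prod>j=1..k. norm (z + \<mu> j))"
      using 1 2 that by (intro mult_mono power_mono prod_mono prod_nonneg conjI) auto
    finally show ?thesis by (simp add: Q_def norm_mult norm_power prod_norm)
  qed
  have Qright: "Q z \<noteq> 0" if "0 < Re z" for z
  proof -
    have "z + \<mu> j \<noteq> 0" if "j \<in> {1..k}" for j
      using \<mu>[OF that] \<open>0 < Re z\<close> by (auto simp: complex_eq_iff)
    thus ?thesis using that by (auto simp: Q_def)
  qed
  have hol: "f holomorphic_on {z. 0 < Re z}"
    unfolding f_def using Qright by (auto intro!: holomorphic_intros simp: Q_def)
  define K where "K = exp (s * \<epsilon>) * \<bar>p\<bar>"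
  have K: "0 \<le> K" by (simp add: K_def)
  \<comment> \<open>The three thresholds for \<open>R\<close> give convergence of the Laurent
    series, validity of \<open>res\<close>, and \<open>1 < R - D\<close>, which allows lowering the
    exponent \<open>k + l\<close> to 2.\<close>
  have main: "2 * pi * \<bar>egf (delay l c) s\<bar> \<le> K * J + K * pi * (R / (R - D) ^ 2)"
    if R: "max (\<epsilon> + B) (max (\<epsilon> + \<bar>r0\<bar>) (D + 1)) < R" for R
  proof -
    have R0: "0 < R" and RD: "1 < R - D" using R \<epsilon> by auto
    have Qpos: "Q z \<noteq> 0" if "z \<in> sphere (of_real \<epsilon>) R" for z
      using Qlow[OF that] RD by (smt (verit) norm_zero zero_less_power)
    have eqf: "(\<Sum>m. of_real (c m) * (exp (of_real s * z) / z ^ Suc (m + l))) = f z"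
      if z: "z \<in> sphere (of_real \<epsilon>) R" for z
    proof -
      have "norm (z - of_real \<epsilon>) = R" using that by (simp add: dist_norm norm_minus_commute)
      hence zn: "R - \<epsilon> \<le> norm z" using norm_triangle_ineq4[of z "of_real \<epsilon>"] \<epsilon> by simp
      hence zB: "B < norm z" "r0 < norm z" using R by auto
      have "summable (\<lambda>m. of_real (c m) / z ^ Suc m)"
      proof (rule summable_comparison_test'[where N=0])
        show "summable (\<lambda>m. (B / norm z) ^ m * (C / norm z))"
          using zB CB by (intro summable_mult2 summable_geometric) (auto simp: divide_less_eq)
        fix m
        have "norm (complex_of_real (c m) / z ^ Suc m) = \<bar>c m\<bar> / norm z ^ Suc m"
          by (simp add: norm_divide norm_mult norm_power)
        also have "\<dots> \<le> C * B ^ m / norm z ^ Suc m" using CB zB by (intro divide_right_mono) auto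
        finally show "norm (complex_of_real (c m) / z ^ Suc m) \<le> (B / norm z) ^ m * (C / norm z)"
          by (simp add: power_divide field_simps)
      qed
      from suminf_mult[OF this, of "exp (of_real s * z) / z ^ l"]
      have "(\<Sum>m. of_real (c m) * (exp (of_real s * z) / z ^ Suc (m + l)))
          = exp (of_real s * z) / z ^ l * (\<Sum>m. of_real (c m) / z ^ Suc m)"
        by (simp add: power_add mult_ac)
      also have "\<dots> = f z"
        using res[OF zB(2)] Qpos[OF z] zB CB(1) by (auto simp: f_def Q_def field_simps)
      finally show ?thesis .
    qed
    have cont: "continuous_on (sphere (of_real \<epsilon>) R) f"
      unfolding f_def
      by (intro continuous_on_divide ballI Qpos) (auto intro!: continuous_intros simp: Q_def)
    have fbnd: "norm (f z) = exp (s * Re z) * \<bar>p\<bar> / norm (Q z)" for z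
      by (simp add: f_def norm_mult norm_divide)
    have "norm (contour_integral (circlepath (of_real \<epsilon>) R) f)
      \<le> integral {-R..R} (\<lambda>x. norm (f (Complex \<epsilon> x))) + K / (R - D) ^ (k + l) * R * pi"
    proof (rule norm_contour_integral_circle_le[OF hol cont \<epsilon> R0])
      show "0 \<le> K / (R - D) ^ (k + l)" using K RD by simp
      fix z assume z: "z \<in> sphere (of_real \<epsilon>) R" "Re z \<le> \<epsilon>"
      have "exp (s * Re z) \<le> exp (s * \<epsilon>)" using z s by (simp add: mult_left_mono)
      thus "norm (f z) \<le> K / (R - D) ^ (k + l)" unfolding fbnd K_def
        using Qlow[OF z(1)] RD by (intro frac_le mult_right_mono) auto
    qed
    also have "contour_integral (circlepath (of_real \<epsilon>) R) f
        = contour_integral (circlepath (of_real \<epsilon>) R)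
            (\<lambda>z. \<Sum>m. of_real (c m) * (exp (of_real s * z) / z ^ Suc (m + l)))"
      using R0 by (intro contour_integral_cong refl eqf[symmetric]) auto
    also have "\<dots> = 2 * pi * \<i> * of_real (egf (delay l c) s)"
      using CB R \<epsilon> by (intro contour_integral_exp_Laurent[of B C]) auto
    also have "norm \<dots> = 2 * pi * \<bar>egf (delay l c) s\<bar>" by (simp add: norm_mult)
    also have "integral {-R..R} (\<lambda>x. norm (f (Complex \<epsilon> x)))
        = K * integral {-R..R} (\<lambda>x. 1 / norm (Complex \<epsilon> x ^ l * (\<Prod>j=1..k. Complex \<epsilon> x + \<mu> j)))"
      unfolding fbnd by (subst Henstock_Kurzweil_Integration.integral_mult_right[symmetric]) (simp add: K_def Q_def)
    also have "\<dots> \<le> K * J" using J[OF R0] K by (intro mult_left_mono) auto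
    also have "K / (R - D) ^ (k + l) * R * pi \<le> K / (R - D) ^ 2 * R * pi"
      using K RD kl R0 by (intro mult_right_mono divide_left_mono power_increasing) auto
    finally show ?thesis by (simp add: mult_ac)
  qed
  have "((\<lambda>R. K * J + K * pi * (R / (R - D) ^ 2)) \<longlongrightarrow> K * J + K * pi * 0) at_top"
    by (intro tendsto_intros) real_asymp
  moreover have "\<forall>\<^sub>F R in at_top. 2 * pi * \<bar>egf (delay l c) s\<bar> \<le> K * J + K * pi * (R / (R - D) ^ 2)"
    using eventually_gt_at_top[of "max (\<epsilon> + B) (max (\<epsilon> + \<bar>r0\<bar>) (D + 1))"]
    by eventually_elim (rule main)
  ultimately have "2 * pi * \<bar>egf (delay l c) s\<bar> \<le> K * J + K * pi * 0"
    by (intro tendsto_lowerbound) auto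
  thus ?thesis by (simp add: K_def)
qed

section \<open>Bounds for the resolvent on the line\<close>

text \<open>\<open>H\<close> is real. This replaces pairing the non-real eigenvalues, whose order in \<open>\<mu>\<close> is arbitrary: the
  square of the modulus is the product of the factors for \<open>\<mu> j\<close> and \<open>cnj (\<mu> j)\<close> over all \<open>j\<close>.\<close>

lemma eigenvalue_enum_prod_cnj:
  assumes H: "H \<in> carrier_mat k k" and \<mu>: "eigenvalue_enum H k k1 \<mu>"
  shows "norm (\<Prod>j=1..k. z + cnj (\<mu> j)) = norm (\<Prod>j=1..k. z + \<mu> j)"
proof -
  let ?q = "char_poly (map_mat complex_of_real H)"
  have q: "?q = (\<Prod>j=1..k. [:- \<mu> j, 1:])" using \<mu> by (simp add: eigenvalue_enum_def)
  have neg: "(\<Prod>j=1..k. w + \<mu> j) = (- 1) ^ k * poly ?q (- w)" for w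
  proof -
    have "(\<Prod>j=1..k. w + \<mu> j) = (\<Prod>j=1..k. (- 1) * (- w - \<mu> j))"
      by (intro prod.cong) auto
    also have "\<dots> = (- 1) ^ k * (\<Prod>j=1..k. - w - \<mu> j)" by (subst prod.distrib) simp
    finally show ?thesis unfolding q poly_prod by (simp add: algebra_simps)
  qed
  have "?q = map_poly of_real (char_poly H)"
    by (rule of_real_hom.char_poly_hom[OF H])
  hence "cnj (poly ?q w) = poly ?q (cnj w)" for w
    by (intro poly_cnj_real) (auto simp: coeff_map_poly)
  hence "norm (poly ?q (cnj w)) = norm (poly ?q w)" for w
    by (metis complex_mod_cnj)
  hence "norm (\<Prod>j=1..k. cnj z + \<mu> j) = norm (\<Prod>j=1..k. z + \<mu> j)"
    unfolding neg by (simp add: norm_mult norm_power flip: complex_cnj_minus)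
  moreover have "(\<Prod>j=1..k. z + cnj (\<mu> j)) = cnj (\<Prod>j=1..k. cnj z + \<mu> j)" by simp
  ultimately show ?thesis by (metis complex_mod_cnj)
qed

lemma r_eig_pos: "0 < \<epsilon> \<Longrightarrow> 0 \<le> Re z \<Longrightarrow> 0 < r_eig \<epsilon> z"
  by (simp add: r_eig_def add_pos_nonneg)

text \<open>With \<open>p\<close>, \<open>b\<close>, \<open>r\<close> as in the proof, the square of
  the right-hand side is \<open>p^2 * (r^2 + x^2)\<close> plus the nonnegative
  \<open>p^2 * x^2 + p^2 * b^2 + (x^2 - b^2)^2\<close>, which is dropped. Spreading the bound evenly
  over the two factors of a pair gives the power 1/4 in \<open>varsigma\<close> and the square root
  in \<open>omega\<close>.\<close>

lemma conj_pair_factor_bound: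
  assumes \<epsilon>: "0 < \<epsilon>" and z: "0 \<le> Re z"
  shows "r_eig \<epsilon> z * (\<epsilon> + Re z) * sqrt (1 + x\<^sup>2 / (r_eig \<epsilon> z)\<^sup>2)
    \<le> norm (Complex \<epsilon> x + z) * norm (Complex \<epsilon> x + cnj z)"
proof -
  define p b r where "p = \<epsilon> + Re z" and "b = Im z" and "r = r_eig \<epsilon> z"
  have r2: "r\<^sup>2 = p\<^sup>2 + b\<^sup>2" by (simp add: r_def r_eig_def p_def b_def)
  have pos: "0 < p" "0 < r" using assms r_eig_pos[OF assms] by (auto simp: p_def r_def)
  have "(r * p * sqrt (1 + x\<^sup>2 / r\<^sup>2))\<^sup>2 = p\<^sup>2 * (r\<^sup>2 + x\<^sup>2)"
    using pos by (simp add: power_mult_distrib field_simps)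
  also have "\<dots> \<le> p\<^sup>2 * (r\<^sup>2 + x\<^sup>2) + (p\<^sup>2 * x\<^sup>2 + p\<^sup>2 * b\<^sup>2 + (x\<^sup>2 - b\<^sup>2)\<^sup>2)"
    by simp
  also have "\<dots> = (p\<^sup>2 + (x + b)\<^sup>2) * (p\<^sup>2 + (x - b)\<^sup>2)"
    unfolding r2 by (simp add: power2_eq_square algebra_simps)
  also have "\<dots> = (norm (Complex \<epsilon> x + z) * norm (Complex \<epsilon> x + cnj z))\<^sup>2"
    by (simp add: power_mult_distrib cmod_power2 p_def b_def)
  finally show ?thesis
    unfolding r_def[symmetric] p_def[symmetric] by (rule power2_le_imp_le) simp
qed

text \<open>For a real eigenvalue both moduli coincide and \<open>r_eig \<epsilon> z\<close> is
  \<open>\<epsilon> + Re z\<close>, so nothing is lost; hence the larger power 1/2 in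
  \<open>varsigma\<close>.\<close>

lemma real_factor_eq:
  assumes \<epsilon>: "0 < \<epsilon>" and z: "0 \<le> Re z" and re: "z \<in> \<real>"
  shows "r_eig \<epsilon> z * (\<epsilon> + Re z) * (1 + x\<^sup>2 / (r_eig \<epsilon> z)\<^sup>2)
    = norm (Complex \<epsilon> x + z) * norm (Complex \<epsilon> x + cnj z)"
proof -
  have im: "Im z = 0" using re by (simp add: complex_is_Real_iff)
  have r: "r_eig \<epsilon> z = \<epsilon> + Re z" using \<epsilon> z im by (simp add: r_eig_def)
  have c: "cnj z = z" using im by (simp add: complex_eq_iff)
  have pos: "0 < \<epsilon> + Re z" using \<epsilon> z by simp
  have "norm (Complex \<epsilon> x + z) * norm (Complex \<epsilon> x + z) = (\<epsilon> + Re z)\<^sup>2 + x\<^sup>2"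
    using im by (simp add: power2_eq_square[symmetric] cmod_power2)
  moreover have "p * p * (1 + x\<^sup>2 / p\<^sup>2) = p\<^sup>2 + x\<^sup>2" if "0 < p" for p :: real
    using that by (simp add: distrib_left power2_eq_square)
  ultimately show ?thesis unfolding r c using pos by simp
qed

lemma omega_varsigma_le:
  assumes H: "H \<in> carrier_mat k k" and \<mu>: "eigenvalue_enum H k k1 \<mu>"
    and re: "\<And>j. j \<in> {1..k} \<Longrightarrow> 0 \<le> Re (\<mu> j)" and \<epsilon>: "0 < \<epsilon>"
  shows "omega k \<mu> \<epsilon> * varsigma k k1 \<mu> \<epsilon> x \<le> norm (\<Prod>j=1..k. Complex \<epsilon> x + \<mu> j)"
proof -
  let ?u = "\<lambda>j. 1 + x\<^sup>2 / (r_eig \<epsilon> (\<mu> j))\<^sup>2"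
  let ?w = "\<lambda>j. r_eig \<epsilon> (\<mu> j) * (\<epsilon> + Re (\<mu> j))"
  define F where "F = (\<lambda>j. sqrt (?w j) * ?u j powr (if j \<le> k1 then 1/2 else 1/4))"
  have k1: "k1 \<le> k" and rl: "\<And>j. j \<in> {1..k} \<Longrightarrow> \<mu> j \<in> \<real> \<longleftrightarrow> j \<le> k1"
    using \<mu> by (auto simp: eigenvalue_enum_def)
  have "varsigma k k1 \<mu> \<epsilon> x = (\<Prod>j=1..k. ?u j powr (if j \<le> k1 then 1/2 else 1/4))"
  proof -
    have "{1..k} = {1..k1} \<union> {k1+1..k}" using k1 by auto
    hence "(\<Prod>j=1..k. ?u j powr (if j \<le> k1 then 1/2 else 1/4))
      = (\<Prod>j=1..k1. ?u j powr (if j \<le> k1 then 1/2 else 1/4)) * (\<Prod>j=k1+1..k. ?u j powr (if j \<le> k1 then 1/2 else 1/4))"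
      by (simp only:) (rule prod.union_disjoint, auto)
    thus ?thesis by (simp add: varsigma_def)
  qed
  hence F: "omega k \<mu> \<epsilon> * varsigma k k1 \<mu> \<epsilon> x = (\<Prod>j=1..k. F j)"
    by (simp add: omega_def F_def prod.distrib)
  have "(\<Prod>j=1..k. F j)\<^sup>2 = (\<Prod>j=1..k. (F j)\<^sup>2)" by (rule prod_power_distrib)
  also have "\<dots> \<le> (\<Prod>j=1..k. norm (Complex \<epsilon> x + \<mu> j) * norm (Complex \<epsilon> x + cnj (\<mu> j)))"
  proof (intro prod_mono conjI)
    fix j assume j: "j \<in> {1..k}"
    have u: "1 \<le> ?u j" by simp
    have w: "0 \<le> ?w j" using re[OF j] r_eig_pos[OF \<epsilon>, of "\<mu> j"] \<epsilon> by simp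
    \<comment> \<open>Squaring doubles the powers 1/2 and 1/4 to 1 and 1/2, the forms in
      \<open>real_factor_eq\<close> and \<open>conj_pair_factor_bound\<close>.\<close>
    have sq: "(F j)\<^sup>2 = ?w j * (?u j powr (2 * (if j \<le> k1 then 1/2 else 1/4)))"
      using w by (simp add: F_def power_mult_distrib power2_eq_square[of "_ powr _"] flip: powr_add)
    show "(F j)\<^sup>2 \<le> norm (Complex \<epsilon> x + \<mu> j) * norm (Complex \<epsilon> x + cnj (\<mu> j))"
    proof (cases "j \<le> k1")
      case True
      with sq u real_factor_eq[OF \<epsilon> re[OF j]] rl[OF j] show ?thesis by (simp add: mult_ac)
    next
      case False
      hence "(F j)\<^sup>2 = ?w j * sqrt (?u j)" using sq u by (simp add: powr_half_sqrt)
      with conj_pair_factor_bound[OF \<epsilon> re[OF j]] show ?thesis by simp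
    qed
  qed simp
  also have "\<dots> = norm (\<Prod>j=1..k. Complex \<epsilon> x + \<mu> j) * norm (\<Prod>j=1..k. Complex \<epsilon> x + cnj (\<mu> j))"
    by (simp add: prod.distrib prod_norm)
  also have "\<dots> = (norm (\<Prod>j=1..k. Complex \<epsilon> x + \<mu> j))\<^sup>2"
    by (simp only: eigenvalue_enum_prod_cnj[OF H \<mu>] power2_eq_square)
  finally show ?thesis unfolding F by (rule power2_le_imp_le) simp
qed

section \<open>The weight and its integrability\<close>

lemma varsigma_pos: "0 < varsigma k k1 \<mu> \<epsilon> x"
proof -
  \<comment> \<open>This includes \<open>y = 0\<close>, where the quotient is 0 by convention; so no
    condition on \<mu> is involved.\<close>
  have "1 + x\<^sup>2 / y\<^sup>2 > 0" for y :: real by (rule add_pos_nonneg) auto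
  hence "1 + x\<^sup>2 / y\<^sup>2 \<noteq> 0" for y :: real by (metis less_irrefl)
  thus ?thesis unfolding varsigma_def by (intro mult_pos_pos prod_pos) auto
qed

text \<open>The integrand of the final bound: an upper estimate of the reciprocal denominator on the
  line, with the constant \<open>omega k \<mu> \<epsilon> * \<epsilon> ^ l\<close> taken
  out.\<close>

definition bound_weight :: "nat \<Rightarrow> nat \<Rightarrow> nat \<Rightarrow> (nat \<Rightarrow> complex) \<Rightarrow> real \<Rightarrow> real \<Rightarrow> real" where
  "bound_weight l k k1 \<mu> \<epsilon> x = (1 + x\<^sup>2 / \<epsilon>\<^sup>2) powr (- real l / 2) / varsigma k k1 \<mu> \<epsilon> x"

lemma bound_weight_nonneg: "0 \<le> bound_weight l k k1 \<mu> \<epsilon> x"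
  using varsigma_pos[of k k1 \<mu> \<epsilon> x] by (simp add: bound_weight_def)

lemma continuous_on_bound_weight: "continuous_on UNIV (bound_weight l k k1 \<mu> \<epsilon>)"
proof -
  have c: "continuous_on UNIV (\<lambda>x::real. (1 + x\<^sup>2 / y\<^sup>2) powr a)" for y a :: real
  proof (rule continuous_on_powr)
    show "continuous_on UNIV (\<lambda>x::real. 1 + x\<^sup>2 / y\<^sup>2)"
      unfolding divide_inverse by (intro continuous_intros)
    have "1 + x\<^sup>2 / y\<^sup>2 > 0" for x :: real by (rule add_pos_nonneg) auto
    thus "\<forall>x\<in>UNIV. 1 + x\<^sup>2 / y\<^sup>2 \<noteq> 0" by (metis less_irrefl)
  qed (rule continuous_on_const)
  have "continuous_on UNIV (varsigma k k1 \<mu> \<epsilon>)"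
    unfolding varsigma_def by (intro continuous_on_mult continuous_on_prod c)
  moreover have "\<forall>x\<in>UNIV. varsigma k k1 \<mu> \<epsilon> x \<noteq> 0"
    using varsigma_pos by (metis less_irrefl)
  ultimately show ?thesis unfolding bound_weight_def by (intro continuous_on_divide c)
qed

text \<open>Replacing \<epsilon> and all \<open>r_eig\<close> by their common upper bound
  \<open>D\<close> leaves a single power of \<open>1 + (x / D)^2\<close>, with exponent
  \<open>- (k + k1 + 2 * l) / 4\<close>; \<open>decay\<close> makes it at most -1.\<close>

lemma bound_weight_le:
  assumes k1: "k1 \<le> k" and decay: "4 \<le> k + k1 + 2 * l"
    and \<epsilon>: "0 < \<epsilon>" "\<epsilon> \<le> D" and r: "\<And>j. j \<in> {1..k} \<Longrightarrow> 0 < r_eig \<epsilon> (\<mu> j) \<and> r_eig \<epsilon> (\<mu> j) \<le> D"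
  shows "bound_weight l k k1 \<mu> \<epsilon> x \<le> inverse (1 + (x / D)\<^sup>2)"
proof -
  define u where "u = 1 + (x / D)\<^sup>2"
  have u: "1 \<le> u" by (simp add: u_def)
  have mono: "u \<le> 1 + x\<^sup>2 / y\<^sup>2" if "0 < y" "y \<le> D" for y
    unfolding u_def power_divide using that
    by (intro add_left_mono divide_left_mono power_mono mult_pos_pos zero_less_power) auto
  have "u powr (real k1 / 2) * u powr ((real k - real k1) / 4)
      = (\<Prod>j=1..k1. u powr (1/2)) * (\<Prod>j=k1+1..k. u powr (1/4))"
    using u k1 by (simp add: powr_realpow[symmetric] powr_powr of_nat_diff)
  also have "\<dots> \<le> varsigma k k1 \<mu> \<epsilon> x"
    unfolding varsigma_def using k1 u r
    by (intro mult_mono prod_mono conjI powr_mono2 mono prod_nonneg) auto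
  finally have v: "u powr (real k1 / 2 + (real k - real k1) / 4) \<le> varsigma k k1 \<mu> \<epsilon> x"
    by (simp add: powr_add)
  have "bound_weight l k k1 \<mu> \<epsilon> x \<le> u powr (- real l / 2) / u powr (real k1 / 2 + (real k - real k1) / 4)"
    unfolding bound_weight_def using v u mono[OF \<epsilon>]
    by (intro frac_le powr_mono2') auto
  also have "\<dots> = u powr (- real l / 2 - (real k1 / 2 + (real k - real k1) / 4))"
    using u by (simp add: powr_diff)
  also have "\<dots> \<le> u powr (- 1)"
  proof (rule powr_mono[OF _ u])
    have "4 \<le> real (k + k1 + 2 * l)" using decay by (metis of_nat_le_iff of_nat_numeral)
    thus "- real l / 2 - (real k1 / 2 + (real k - real k1) / 4) \<le> - 1"
      unfolding of_nat_add of_nat_mult of_nat_numeral by (simp add: field_simps)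
  qed
  finally show ?thesis using u by (simp add: powr_minus u_def)
qed

text \<open>Needed because \<open>LBINT\<close> of a non-integrable function is 0 by convention and
  would then fail to dominate the integrals over finite segments. The majorant is a rescaled
  \<open>1 / (1 + x^2)\<close>.\<close>

lemma set_integrable_bound_weight:
  assumes k1: "k1 \<le> k" and decay: "4 \<le> k + k1 + 2 * l" and \<epsilon>: "0 < \<epsilon>"
    and re: "\<And>j. j \<in> {1..k} \<Longrightarrow> 0 \<le> Re (\<mu> j)"
  shows "set_integrable lborel {0..} (bound_weight l k k1 \<mu> \<epsilon>)"
proof -
  define D where "D = \<epsilon> + (\<Sum>j=1..k. r_eig \<epsilon> (\<mu> j))"
  have rpos: "0 < r_eig \<epsilon> (\<mu> j)" if "j \<in> {1..k}" for j using r_eig_pos[OF \<epsilon> re[OF that]] .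
  have rD: "r_eig \<epsilon> (\<mu> j) \<le> D" if "j \<in> {1..k}" for j
  proof -
    have "r_eig \<epsilon> (\<mu> j) \<le> (\<Sum>j=1..k. r_eig \<epsilon> (\<mu> j))"
      using that rpos by (intro member_le_sum) (auto intro: less_imp_le)
    thus ?thesis using \<epsilon> by (simp add: D_def)
  qed
  have "0 \<le> (\<Sum>j=1..k. r_eig \<epsilon> (\<mu> j))" by (intro sum_nonneg less_imp_le rpos)
  hence D: "\<epsilon> \<le> D" "0 < D" using \<epsilon> by (auto simp: D_def)
  have "integrable lborel (\<lambda>x::real. inverse (1 + x\<^sup>2))"
    using integrable_inverse_1_plus_square by (simp add: set_integrable_def einterval_def)
  from lborel_integrable_real_affine[OF this, of "1 / D" 0]
  have i: "integrable lborel (\<lambda>x. inverse (1 + (x / D)\<^sup>2))" using D by simp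
  have m: "bound_weight l k k1 \<mu> \<epsilon> \<in> borel_measurable borel"
    by (rule borel_measurable_continuous_onI[OF continuous_on_bound_weight])
  show ?thesis unfolding set_integrable_def
  proof (rule Bochner_Integration.integrable_bound[OF i])
    show "(\<lambda>x. indicat_real {0..} x *\<^sub>R bound_weight l k k1 \<mu> \<epsilon> x) \<in> borel_measurable lborel"
      using m by measurable
    show "AE x in lborel. norm (indicat_real {0..} x *\<^sub>R bound_weight l k k1 \<mu> \<epsilon> x) \<le> norm (inverse (1 + (x / D)\<^sup>2))"
    proof (rule AE_I2)
      fix x
      have "bound_weight l k k1 \<mu> \<epsilon> x \<le> inverse (1 + (x / D)\<^sup>2)"
        using bound_weight_le[OF k1 decay \<epsilon> D(1)] rpos rD by blast
      moreover have "0 \<le> inverse (1 + (x / D)\<^sup>2)" by simp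
      ultimately show "norm (indicat_real {0..} x *\<^sub>R bound_weight l k k1 \<mu> \<epsilon> x) \<le> norm (inverse (1 + (x / D)\<^sup>2))"
        using bound_weight_nonneg[of l k k1 \<mu> \<epsilon> x] by (simp add: indicator_def)
    qed
  qed
qed

text \<open>Evenness folds the segment onto \<open>{0..R}\<close>, and nonnegativity extends the
  range to the half-line. The factor 2 later cancels against \<open>2 * pi\<close>, leaving
  \<open>pi\<close> in the constant.\<close>

lemma integral_symmetric_le_LBINT:
  fixes f :: "real \<Rightarrow> real"
  assumes f: "set_integrable lborel {0..} f" and nonneg: "\<And>x. 0 \<le> f x" and even: "\<And>x. f (- x) = f x"
    and R: "0 < R"
  shows "f integrable_on {-R..R}" "integral {-R..R} f \<le> 2 * (LBINT x:{0..}. f x)"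
proof -
  have fR: "set_integrable lborel {0..R} f" by (rule set_integrable_subset[OF f]) auto
  have h: "(f has_integral integral {0..R} f) {0..R}"
    using set_borel_integral_eq_integral(1)[OF fR] by blast
  hence "((\<lambda>x. f (- x)) has_integral integral {0..R} f) {-R..-0}"
    by (subst has_integral_reflect_real)
  hence "(f has_integral integral {0..R} f) {-R..0}" by (simp add: even)
  from has_integral_combine[OF _ _ this h] R
  have c: "(f has_integral integral {0..R} f + integral {0..R} f) {-R..R}" by simp
  thus "f integrable_on {-R..R}" by blast
  have "integral {0..R} f = (LBINT x:{0..R}. f x)"
    by (rule set_borel_integral_eq_integral(2)[OF fR, symmetric])
  also have "\<dots> \<le> (LBINT x:{0..}. f x)"
    unfolding set_lebesgue_integral_def using f fR nonneg
    by (intro integral_mono) (auto simp: set_integrable_def indicator_def)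
  finally show "integral {-R..R} f \<le> 2 * (LBINT x:{0..}. f x)"
    using c by (simp add: integral_unique)
qed

text \<open>The \<open>l\<close>-th power of \<open>norm (Complex \<epsilon> x) = \<epsilon> * sqrt
  (1 + x^2 / \<epsilon>^2)\<close> provides \<open>\<epsilon> ^ l\<close> and the first factor of
  \<open>bound_weight\<close>; \<open>omega_varsigma_le\<close> handles the product.\<close>

lemma integral_resolvent_le:
  assumes H: "H \<in> carrier_mat k k" and \<mu>: "eigenvalue_enum H k k1 \<mu>"
    and re: "\<And>j. j \<in> {1..k} \<Longrightarrow> 0 \<le> Re (\<mu> j)" and \<epsilon>: "0 < \<epsilon>"
    and decay: "4 \<le> k + k1 + 2 * l" and R: "0 < R"
  shows "integral {-R..R} (\<lambda>x. 1 / norm (Complex \<epsilon> x ^ l * (\<Prod>j=1..k. Complex \<epsilon> x + \<mu> j)))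
    \<le> 2 * (LBINT x:{0..}. bound_weight l k k1 \<mu> \<epsilon> x) / (omega k \<mu> \<epsilon> * \<epsilon> ^ l)"
proof -
  have k1: "k1 \<le> k" using \<mu> by (simp add: eigenvalue_enum_def)
  have om: "0 < omega k \<mu> \<epsilon>"
    unfolding omega_def using re r_eig_pos[OF \<epsilon> re] \<epsilon>
    by (intro prod_pos) (auto intro!: mult_pos_pos add_pos_nonneg)
  define K where "K = 1 / (omega k \<mu> \<epsilon> * \<epsilon> ^ l)"
  have K: "0 \<le> K" using om \<epsilon> by (simp add: K_def)
  have w: "bound_weight l k k1 \<mu> \<epsilon> integrable_on {-R..R}"
    "integral {-R..R} (bound_weight l k k1 \<mu> \<epsilon>) \<le> 2 * (LBINT x:{0..}. bound_weight l k k1 \<mu> \<epsilon> x)"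
    by (rule integral_symmetric_le_LBINT[OF set_integrable_bound_weight[OF k1 decay \<epsilon> re] bound_weight_nonneg _ R];
        simp add: bound_weight_def varsigma_def)+
  have pt: "1 / norm (Complex \<epsilon> x ^ l * (\<Prod>j=1..k. Complex \<epsilon> x + \<mu> j)) \<le> K * bound_weight l k k1 \<mu> \<epsilon> x" for x
  proof -
    have u: "0 < 1 + x\<^sup>2 / \<epsilon>\<^sup>2" by (rule add_pos_nonneg) auto
    have "norm (Complex \<epsilon> x) = \<epsilon> * sqrt (1 + x\<^sup>2 / \<epsilon>\<^sup>2)"
    proof -
      have "\<epsilon>\<^sup>2 + x\<^sup>2 = \<epsilon>\<^sup>2 * (1 + x\<^sup>2 / \<epsilon>\<^sup>2)" using \<epsilon> by (simp add: field_simps)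
      thus ?thesis using \<epsilon> by (simp add: complex_norm real_sqrt_mult)
    qed
    also have "sqrt (1 + x\<^sup>2 / \<epsilon>\<^sup>2) = (1 + x\<^sup>2 / \<epsilon>\<^sup>2) powr (1/2)" using u by (simp add: powr_half_sqrt)
    finally have nl: "norm (Complex \<epsilon> x) ^ l = \<epsilon> ^ l * (1 + x\<^sup>2 / \<epsilon>\<^sup>2) powr (real l / 2)"
      using u by (simp add: power_mult_distrib powr_power mult.commute)
    have "1 / norm (Complex \<epsilon> x ^ l * (\<Prod>j=1..k. Complex \<epsilon> x + \<mu> j))
      \<le> 1 / (\<epsilon> ^ l * (1 + x\<^sup>2 / \<epsilon>\<^sup>2) powr (real l / 2) * (omega k \<mu> \<epsilon> * varsigma k k1 \<mu> \<epsilon> x))"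
      unfolding norm_mult norm_power nl
    proof (intro divide_left_mono mult_left_mono mult_pos_pos)
      show le: "omega k \<mu> \<epsilon> * varsigma k k1 \<mu> \<epsilon> x \<le> norm (\<Prod>j=1..k. Complex \<epsilon> x + \<mu> j)"
        by (rule omega_varsigma_le[OF H \<mu> re \<epsilon>])
      show "0 < norm (\<Prod>j=1..k. Complex \<epsilon> x + \<mu> j)"
        by (rule less_le_trans[OF mult_pos_pos[OF om varsigma_pos] le])
    qed (use \<epsilon> u om varsigma_pos[of k k1 \<mu> \<epsilon> x] in auto)
    also have "\<dots> = K * bound_weight l k k1 \<mu> \<epsilon> x"
      using u by (simp add: K_def bound_weight_def powr_minus field_simps)
    finally show ?thesis .
  qed
  have ne: "Complex \<epsilon> x ^ l * (\<Prod>j=1..k. Complex \<epsilon> x + \<mu> j) \<noteq> 0" for x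
  proof -
    have "Complex \<epsilon> x + \<mu> j \<noteq> 0" if "j \<in> {1..k}" for j
      using re[OF that] \<epsilon> by (auto simp: complex_eq_iff)
    moreover have "Complex \<epsilon> x \<noteq> 0" using \<epsilon> by (auto simp: complex_eq_iff)
    ultimately show ?thesis by auto
  qed
  have "continuous_on {-R..R} (\<lambda>x. 1 / norm (Complex \<epsilon> x ^ l * (\<Prod>j=1..k. Complex \<epsilon> x + \<mu> j)))"
    by (intro continuous_on_divide continuous_intros ballI) (use ne in \<open>auto simp: Complex_eq intro!: continuous_intros\<close>)
  hence "integral {-R..R} (\<lambda>x. 1 / norm (Complex \<epsilon> x ^ l * (\<Prod>j=1..k. Complex \<epsilon> x + \<mu> j)))
      \<le> integral {-R..R} (\<lambda>x. K * bound_weight l k k1 \<mu> \<epsilon> x)"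
    using pt integrable_cmul[OF w(1), of K] by (intro integral_le[OF integrable_continuous_interval]) auto
  also have "\<dots> = K * integral {-R..R} (bound_weight l k k1 \<mu> \<epsilon>)" by simp
  also have "\<dots> \<le> K * (2 * (LBINT x:{0..}. bound_weight l k k1 \<mu> \<epsilon> x))"
    using w(2) K by (rule mult_left_mono)
  finally show ?thesis by (simp add: K_def)
qed

section \<open>Hessenberg resolvent, numerical range and energy estimate\<close>

lemma Re_ge_of_sector:
  assumes "z \<in> sector \<theta> a" "\<theta> \<le> pi / 2"
  shows "a \<le> Re z"
proof -
  define u where "u = z - of_real a"
  have "\<bar>Arg u\<bar> \<le> pi / 2" using assms by (simp add: sector_def u_def)
  hence "0 \<le> norm u * cos (Arg u)" by (intro mult_nonneg_nonneg cos_ge_zero) auto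
  also have "\<dots> = Re u" by (metis Re_rcis rcis_cmod_Arg)
  finally show ?thesis by (simp add: u_def)
qed

text \<open>A real vector, viewed as a complex one, has a real Rayleigh quotient, and the sector
  bounds it below by \<open>a\<close>. The sums over real functions match the hypothesis of
  \<open>energy_estimate\<close>.\<close>

lemma numerical_range_coercive:
  assumes A: "A \<in> carrier_mat n n" and W: "numerical_range (map_mat complex_of_real A) \<subseteq> sector \<theta> a"
    and \<theta>: "\<theta> \<le> pi / 2"
  shows "a * (\<Sum>i<n. (x i)\<^sup>2) \<le> (\<Sum>i<n. x i * (\<Sum>j<n. A $$ (i, j) * x j))"
proof (cases "\<forall>i<n. x i = 0")
  case False
  define X where "X = Matrix.vec n (\<lambda>i. complex_of_real (x i))"
  obtain i where i: "i < n" "x i \<noteq> 0" using False by blast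
  hence "X $ i \<noteq> 0\<^sub>v n $ i" by (simp add: X_def)
  hence X: "X \<in> carrier_vec n" "X \<noteq> 0\<^sub>v n" by (auto simp: X_def)
  have 1: "X \<bullet>c X = of_real (\<Sum>i<n. (x i)\<^sup>2)"
    by (auto simp: X_def scalar_prod_def atLeast0LessThan power2_eq_square intro!: sum.cong)
  have 2: "(map_mat complex_of_real A *\<^sub>v X) \<bullet>c X = of_real (\<Sum>i<n. x i * (\<Sum>j<n. A $$ (i, j) * x j))"
    using A by (auto simp: X_def scalar_prod_def atLeast0LessThan mult.commute intro!: sum.cong)
  have pos: "0 < (\<Sum>i<n. (x i)\<^sup>2)"
    using i by (intro sum_pos2[of _ i]) auto
  have "(map_mat complex_of_real A *\<^sub>v X) \<bullet>c X / (X \<bullet>c X) \<in> numerical_range (map_mat complex_of_real A)"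
    unfolding numerical_range_def using X A by (auto intro!: exI[of _ X])
  hence "a \<le> Re ((map_mat complex_of_real A *\<^sub>v X) \<bullet>c X / (X \<bullet>c X))"
    using W Re_ge_of_sector[OF _ \<theta>] by blast
  also have "\<dots> = (\<Sum>i<n. x i * (\<Sum>j<n. A $$ (i, j) * x j)) / (\<Sum>i<n. (x i)\<^sup>2)"
    unfolding 1 2 by (simp flip: of_real_divide)
  finally show ?thesis using pos by (simp add: pos_le_divide_eq)
qed simp

text \<open>The rank-one term of the Arnoldi relation affects only the last column, hence the case
  split; in entrywise form the relation carries over directly to the complexified matrices.\<close>

lemma
  assumes "arnoldi n k A v V w H h" and A: "A \<in> carrier_mat n n" and k: "1 \<le> k"
  shows arnoldi_carrier: "V \<in> carrier_mat n k" "w \<in> carrier_vec n" "H \<in> carrier_mat k k"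
    and arnoldi_col_0: "col V 0 = (1 / vnorm v) \<cdot>\<^sub>v v"
    and arnoldi_orthonormal: "transpose_mat V * V = 1\<^sub>m k" "w \<bullet> w = 1" "\<And>j. j < k \<Longrightarrow> w \<bullet> col V j = 0"
    and arnoldi_hessenberg: "upper_hessenberg H" "\<And>j. j < k - 1 \<Longrightarrow> 0 \<le> H $$ (Suc j, j)"
    and arnoldi_relation: "\<And>i j. i < n \<Longrightarrow> j < k \<Longrightarrow>
      (A * V) $$ (i, j) = (V * H) $$ (i, j) + (if j = k - 1 then h * w $ i else 0)"
proof -
  define W where "W = mat_of_cols n (cols V @ [w])"
  have a: "V \<in> carrier_mat n k" "w \<in> carrier_vec n" "H \<in> carrier_mat k k"
    "transpose_mat W * W = 1\<^sub>m (k + 1)"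
    "A * V = V * H + h \<cdot>\<^sub>m (mat_of_cols n [w] * mat_of_rows k [unit_vec k (k - 1)])"
    using assms(1) by (auto simp: arnoldi_def Let_def W_def)
  thus "V \<in> carrier_mat n k" "w \<in> carrier_vec n" "H \<in> carrier_mat k k" by auto
  show "col V 0 = (1 / vnorm v) \<cdot>\<^sub>v v" "upper_hessenberg H" "\<And>j. j < k - 1 \<Longrightarrow> 0 \<le> H $$ (Suc j, j)"
    using assms(1) by (auto simp: arnoldi_def)
  have len: "length (cols V @ [w]) = k + 1" using a by simp
  have W: "W \<in> carrier_mat n (k + 1)" unfolding W_def using a by (intro mat_of_cols_carrier(1)[of n "cols V @ [w]", unfolded len])
  have colW: "col W j = (if j < k then col V j else w)" if "j < k + 1" for j
  proof -
    have "set (cols V @ [w]) \<subseteq> carrier_vec n" using a by (auto simp: cols_def)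
    hence "col W j = (cols V @ [w]) ! j"
      unfolding W_def using that a by (intro col_mat_of_cols) (auto simp: nth_append)
    thus ?thesis using that a by (auto simp: nth_append)
  qed
  have ent: "col W i \<bullet> col W j = (if i = j then 1 else 0)" if "i < k + 1" "j < k + 1" for i j
    using arg_cong[OF a(4), of "\<lambda>M. M $$ (i, j)"] W that by auto
  show "transpose_mat V * V = 1\<^sub>m k"
  proof (rule eq_matI)
    fix i j assume "i < dim_row (1\<^sub>m k :: real mat)" "j < dim_col (1\<^sub>m k :: real mat)"
    thus "(transpose_mat V * V) $$ (i, j) = 1\<^sub>m k $$ (i, j)"
      using ent[of i j] colW[of i] colW[of j] a(1) by simp
  qed (use a in auto)
  show "w \<bullet> w = 1" using ent[of k k] colW by simp
  show "w \<bullet> col V j = 0" if "j < k" for j using ent[of k j] colW that by simp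
  show "(A * V) $$ (i, j) = (V * H) $$ (i, j) + (if j = k - 1 then h * w $ i else 0)" if "i < n" "j < k" for i j
    unfolding a(5) using a that k
    by (auto simp: scalar_prod_def mat_of_cols_def mat_of_rows_def)
qed

text \<open>Stated over a commutative ring because it serves real matrices in the Krylov recurrence
  and complexified ones for eigenvectors.\<close>

lemma Arnoldi_relation_vec:
  fixes A V H :: "'a::comm_ring_1 mat"
  assumes "A \<in> carrier_mat n n" "V \<in> carrier_mat n k" "H \<in> carrier_mat k k" "w \<in> carrier_vec n"
    and k: "1 \<le> k" and x: "x \<in> carrier_vec k"
    and rel: "\<And>i j. i < n \<Longrightarrow> j < k \<Longrightarrow> (A * V) $$ (i, j) = (V * H) $$ (i, j) + (if j = k - 1 then h * w $ i else 0)"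
  shows "A *\<^sub>v (V *\<^sub>v x) = V *\<^sub>v (H *\<^sub>v x) + (h * x $ (k - 1)) \<cdot>\<^sub>v w"
proof -
  have AV: "A *\<^sub>v (V *\<^sub>v x) = (A * V) *\<^sub>v x" "V *\<^sub>v (H *\<^sub>v x) = (V * H) *\<^sub>v x"
    using assms by (auto intro!: assoc_mult_mat_vec[symmetric])
  have ent: "(M *\<^sub>v x) $ i = (\<Sum>j<k. M $$ (i, j) * x $ j)" if "M \<in> carrier_mat n k" "i < n" for M i
    using that x by (auto simp: scalar_prod_def atLeast0LessThan)
  show ?thesis unfolding AV
  proof (rule eq_vecI)
    fix i assume "i < dim_vec ((V * H) *\<^sub>v x + (h * x $ (k - 1)) \<cdot>\<^sub>v w)"
    hence i: "i < n" using assms by simp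
    have "((A * V) *\<^sub>v x) $ i = (\<Sum>j<k. (A * V) $$ (i, j) * x $ j)"
      by (rule ent) (use assms i in auto)
    also have "\<dots> = (\<Sum>j<k. (V * H) $$ (i, j) * x $ j + (if j = k - 1 then h * w $ i * x $ j else 0))"
      using rel[OF i] by (intro sum.cong) (auto simp: distrib_right)
    also have "\<dots> = ((V * H) *\<^sub>v x) $ i + h * w $ i * x $ (k - 1)"
      using k ent[of "V * H" i] assms i by (simp add: sum.distrib)
    finally show "((A * V) *\<^sub>v x) $ i = ((V * H) *\<^sub>v x + (h * x $ (k - 1)) \<cdot>\<^sub>v w) $ i"
      using assms i by (simp add: mult_ac)
  qed (use assms in auto)
qed

text \<open>\<open>H\<close> is the compression of \<open>A\<close> to the range of
  \<open>V\<close>: for an eigenvector \<open>x\<close> and \<open>y = V x\<close>, the extra term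
  in \<open>A y\<close> points along \<open>w\<close>, orthogonal to \<open>y\<close>, so the
  Rayleigh quotient of \<open>A\<close> at \<open>y\<close> is \<mu>. Orthonormal columns make
  \<open>y\<close> nonzero.\<close>

lemma arnoldi_eigenvalue_in_numerical_range:
  assumes arn: "arnoldi n k A v V w H h" and A: "A \<in> carrier_mat n n" and k: "1 \<le> k"
    and ev: "eigenvalue (map_mat complex_of_real H) \<mu>"
  shows "\<mu> \<in> numerical_range (map_mat complex_of_real A)"
proof -
  note car = arnoldi_carrier[OF arn A k] and orth = arnoldi_orthonormal[OF arn A k]
  let ?A = "map_mat complex_of_real A" and ?V = "map_mat complex_of_real V" and ?H = "map_mat complex_of_real H"
    and ?w = "map_vec complex_of_real w"
  obtain x where x: "x \<in> carrier_vec k" "x \<noteq> 0\<^sub>v k" "?H *\<^sub>v x = \<mu> \<cdot>\<^sub>v x"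
    using ev car by (auto simp: eigenvalue_def eigenvector_def)
  define y where "y = ?V *\<^sub>v x"
  have y: "y \<in> carrier_vec n" using car x by (auto simp: y_def)
  have VV: "map_mat complex_of_real (transpose_mat V * V) = transpose_mat ?V * ?V"
    using of_real_hom.mat_hom_mult[of "transpose_mat V" k n V k] car
    by (simp add: map_mat_transpose)
  have "transpose_mat ?V *\<^sub>v y = (transpose_mat ?V * ?V) *\<^sub>v x"
    unfolding y_def by (rule assoc_mult_mat_vec[symmetric]) (use car x in auto)
  also have "\<dots> = x" unfolding VV[symmetric] orth(1) of_real_hom.mat_hom_one using x by simp
  finally have "y \<noteq> 0\<^sub>v n" using x car by auto
  hence yy: "y \<bullet>c y \<noteq> 0" using y by auto
  have "?A *\<^sub>v y = ?V *\<^sub>v (?H *\<^sub>v x) + (of_real h * x $ (k - 1)) \<cdot>\<^sub>v ?w"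
    unfolding y_def
  proof (rule Arnoldi_relation_vec)
    fix i j assume ij: "i < n" "j < k"
    show "(?A * ?V) $$ (i, j) = (?V * ?H) $$ (i, j) + (if j = k - 1 then of_real h * ?w $ i else 0)"
      using arg_cong[OF arnoldi_relation[OF arn A k ij], of complex_of_real] ij car A
        of_real_hom.mat_hom_mult[of A n n V k] of_real_hom.mat_hom_mult[of V n k H k]
      by (simp flip: of_real_hom.mat_hom_mult)
  qed (use car A k x in auto)
  also have "?V *\<^sub>v (?H *\<^sub>v x) = \<mu> \<cdot>\<^sub>v y"
    unfolding x(3) y_def using car x by (simp add: mult_mat_vec)
  finally have Ay: "?A *\<^sub>v y = \<mu> \<cdot>\<^sub>v y + (of_real h * x $ (k - 1)) \<cdot>\<^sub>v ?w" .
  have wy: "?w \<bullet>c y = 0"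
  proof -
    have "?w \<bullet>c y = (\<Sum>i<n. \<Sum>j<k. of_real (w $ i * V $$ (i, j)) * cnj (x $ j))"
      using car x y unfolding y_def
      by (auto simp: scalar_prod_def atLeast0LessThan sum_distrib_left mult_ac intro!: sum.cong)
    also have "\<dots> = (\<Sum>j<k. of_real (\<Sum>i<n. w $ i * V $$ (i, j)) * cnj (x $ j))"
      by (subst sum.swap) (simp add: sum_distrib_right)
    also have "\<dots> = (\<Sum>j<k. of_real (w \<bullet> col V j) * cnj (x $ j))"
      using car by (intro sum.cong) (auto simp: scalar_prod_def atLeast0LessThan)
    finally show ?thesis using orth(3) by simp
  qed
  have "(?A *\<^sub>v y) \<bullet>c y = \<mu> * (y \<bullet>c y)"
    unfolding Ay using y car wy by (simp add: add_scalar_prod_distrib[of _ n])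
  with yy have "\<mu> = (?A *\<^sub>v y) \<bullet>c y / (y \<bullet>c y)" by simp
  thus ?thesis unfolding numerical_range_def using y \<open>y \<noteq> 0\<^sub>v n\<close> A by auto
qed

section \<open>Resolvent of a Hessenberg matrix\<close>

lemma eigenvalue_enum_eigenvalue:
  assumes H: "H \<in> carrier_mat k k" and \<mu>: "eigenvalue_enum H k k1 \<mu>" and j: "j \<in> {1..k}"
  shows "eigenvalue (map_mat complex_of_real H) (\<mu> j)"
proof -
  have "poly (char_poly (map_mat complex_of_real H)) (\<mu> j) = 0"
    using \<mu> j by (auto simp: eigenvalue_enum_def poly_prod intro!: prod_zero bexI[of _ j])
  thus ?thesis using H by (subst eigenvalue_root_char_poly) auto
qed

text \<open>Both sides are the characteristic polynomial at \<open>- z\<close> up to the same sign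
  \<open>(- 1) ^ k\<close>.\<close>

lemma det_shift_eq_prod:
  assumes H: "H \<in> carrier_mat k k" and \<mu>: "eigenvalue_enum H k k1 \<mu>"
  shows "det (z \<cdot>\<^sub>m 1\<^sub>m k + map_mat complex_of_real H) = (\<Prod>j=1..k. z + \<mu> j)"
proof -
  let ?H = "map_mat complex_of_real H" and ?M = "z \<cdot>\<^sub>m 1\<^sub>m k + map_mat complex_of_real H"
  have Hc: "?H \<in> carrier_mat k k" using H by simp
  have "- (char_matrix ?H (- z)) = (- 1) \<cdot>\<^sub>m ?M"
    using H by (intro eq_matI) (auto simp: char_matrix_def)
  hence "poly (char_poly ?H) (- z) = (- 1) ^ k * det ?M"
    using H by (simp add: char_poly_matrix[OF Hc] det_smult)
  moreover have "poly (char_poly ?H) (- z) = (\<Prod>j=1..k. (- 1) * (z + \<mu> j))"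
    using \<mu> by (auto simp: eigenvalue_enum_def poly_prod algebra_simps intro!: prod.cong)
  moreover have "\<dots> = (- 1) ^ k * (\<Prod>j=1..k. z + \<mu> j)" by (subst prod.distrib) simp
  ultimately show ?thesis by simp
qed

text \<open>Deleting the first row and the last column moves the subdiagonal of \<open>H\<close>
  onto the diagonal and \<open>z\<close> above it. The minor is then upper triangular, and its
  determinant does not depend on \<open>z\<close>.\<close>

lemma cofactor_hessenberg:
  fixes H :: "'a::idom mat"
  assumes H: "H \<in> carrier_mat k k" and hess: "upper_hessenberg H" and k: "1 \<le> k"
  shows "cofactor (z \<cdot>\<^sub>m 1\<^sub>m k + H) 0 (k - 1) = (- 1) ^ (k - 1) * (\<Prod>j<k-1. H $$ (Suc j, j))"
proof -
  let ?D = "mat_delete (z \<cdot>\<^sub>m 1\<^sub>m k + H) 0 (k - 1)"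
  have D: "?D \<in> carrier_mat (k - 1) (k - 1)" using H by (auto simp: mat_delete_def)
  have ent: "?D $$ (i, j) = (if Suc i = j then z else 0) + H $$ (Suc i, j)" if "i < k - 1" "j < k - 1" for i j
    using H that by (auto simp: mat_delete_def)
  have "upper_triangular ?D"
    using D ent hess H by (auto simp: upper_hessenberg_def)
  hence "det ?D = prod_list (diag_mat ?D)" using D by (rule det_upper_triangular)
  also have "\<dots> = (\<Prod>j<k-1. H $$ (Suc j, j))"
    using D ent H by (auto simp: prod_list_diag_prod atLeast0LessThan intro!: prod.cong)
  finally show ?thesis by (simp add: cofactor_def)
qed

lemma uminus_pow_mat_vec_Suc_index:
  fixes N :: "real mat"
  assumes N: "N \<in> carrier_mat n n" and x: "x \<in> carrier_vec n" and i: "i < n"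
  shows "((- N) ^\<^sub>m Suc m *\<^sub>v x) $ i = - (\<Sum>j<n. N $$ (i, j) * ((- N) ^\<^sub>m m *\<^sub>v x) $ j)"
proof -
  have nN: "- N \<in> carrier_mat n n" using N by simp
  define p where "p = (- N) ^\<^sub>m m *\<^sub>v x"
  have p: "p \<in> carrier_vec n" unfolding p_def using pow_carrier_mat[OF nN] x by (rule mult_mat_vec_carrier)
  have "((- N) ^\<^sub>m Suc m *\<^sub>v x) $ i = (- N *\<^sub>v p) $ i"
    unfolding p_def by (simp only: pow_mat_vec_Suc[OF nN x])
  also have "\<dots> = - (\<Sum>j<n. N $$ (i, j) * p $ j)"
    using N p i by (simp add: scalar_prod_def atLeast0LessThan sum_negf)
  finally show ?thesis by (simp add: p_def)
qed

text \<open>For large \<open>z\<close> the Neumann series solves \<open>(z + H) x = e_1\<close>.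
  Multiplication by the adjugate shows that \<open>det (z + H)\<close> times the last entry of
  \<open>x\<close> is a cofactor; no inverse has to be formed.\<close>

lemma resolvent_entry:
  assumes H: "H \<in> carrier_mat k k" and hess: "upper_hessenberg H" and k: "1 \<le> k"
    and \<mu>: "eigenvalue_enum H k k1 \<mu>"
  obtains r0 where "\<And>z. r0 < norm z \<Longrightarrow>
    (\<Sum>m. of_real (((- H) ^\<^sub>m m *\<^sub>v unit_vec k 0) $ (k - 1)) / z ^ Suc m) * (\<Prod>j=1..k. z + \<mu> j)
      = of_real ((- 1) ^ (k - 1) * (\<Prod>j<k-1. H $$ (Suc j, j)))"
proof -
  define c where "c = (\<lambda>i m. ((- H) ^\<^sub>m m *\<^sub>v unit_vec k 0) $ i)"
  have nH: "- H \<in> carrier_mat k k" using H by simp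
  have c: "exp_type (c i)" if "i < k" for i
    unfolding c_def by (rule exp_type_pow_mat_vec[OF nH _ that]) simp
  hence "\<forall>i\<in>{..<k}. \<exists>C B. 1 \<le> B \<and> (\<forall>m. \<bar>c i m\<bar> \<le> C * B ^ m)" by (auto simp: exp_type_def)
  then obtain C B where CB: "\<And>i. i < k \<Longrightarrow> 1 \<le> B i" "\<And>i m. i < k \<Longrightarrow> \<bar>c i m\<bar> \<le> C i * B i ^ m"
    by (metis lessThan_iff)
  \<comment> \<open>The sum dominates each growth rate and is at least 1 because
    \<open>k \<ge> 1\<close>, so \<open>z\<close> is nonzero beyond \<open>r0\<close>.\<close>
  define r0 where "r0 = sum B {..<k}"
  have Br0: "B i \<le> r0" if "i < k" for i
    unfolding r0_def using that CB by (intro member_le_sum) (auto intro: order_trans[OF zero_le_one])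
  have r0: "1 \<le> r0" using Br0[of 0] CB(1)[of 0] k by simp
  have c_Suc: "c i (Suc m) = - (\<Sum>j<k. H $$ (i, j) * c j m)" if "i < k" for i m
    unfolding c_def by (rule uminus_pow_mat_vec_Suc_index[OF H _ that]) simp
  have c_0: "c i 0 = (if i = 0 then 1 else 0)" if "i < k" for i
    using that H by (auto simp: c_def)
  show ?thesis
  proof (rule that)
    fix z :: complex assume z: "r0 < norm z"
    hence z0: "z \<noteq> 0" using r0 by auto
    let ?M = "z \<cdot>\<^sub>m 1\<^sub>m k + map_mat complex_of_real H"
    define x where "x = (\<lambda>i. \<Sum>m. of_real (c i m) / z ^ Suc m)"
    have sm: "summable (\<lambda>m. of_real (c i m) / z ^ Suc m)" if i: "i < k" for i
    proof (rule summable_comparison_test'[where N=0])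
      have "B i < norm z" using Br0[OF i] z by simp
      thus "summable (\<lambda>m. (B i / norm z) ^ m * (C i / norm z))"
        using CB(1)[OF i] by (intro summable_mult2 summable_geometric) (auto simp: divide_less_eq)
      fix m
      have "norm (complex_of_real (c i m) / z ^ Suc m) = \<bar>c i m\<bar> / norm z ^ Suc m"
        by (simp add: norm_divide norm_mult norm_power)
      also have "\<dots> \<le> C i * B i ^ m / norm z ^ Suc m"
        using CB(2)[OF i] by (intro divide_right_mono) auto
      finally show "norm (complex_of_real (c i m) / z ^ Suc m) \<le> (B i / norm z) ^ m * (C i / norm z)"
        by (simp add: power_divide field_simps)
    qed
    \<comment> \<open>Multiplying by \<open>z\<close> shifts the series by one index: the term split
      off, \<open>c i 0\<close>, is the entry of \<open>e_1\<close>, and the rest is that of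
      \<open>- H x\<close> by \<open>c_Suc\<close>.\<close>
    have Mx: "z * x i + (\<Sum>j<k. of_real (H $$ (i, j)) * x j) = (if i = 0 then 1 else 0)" if i: "i < k" for i
    proof -
      have s1: "(\<lambda>m. of_real (c i m) / z ^ Suc m) sums x i" unfolding x_def by (rule summable_sums[OF sm[OF i]])
      from sums_mult[OF this, of z] z0 have "(\<lambda>m. of_real (c i m) / z ^ m) sums (z * x i)" by simp
      hence "(\<lambda>m. of_real (c i (Suc m)) / z ^ Suc m) sums (z * x i - of_real (c i 0))"
        by (subst sums_Suc_iff) simp
      moreover have "(\<lambda>m. of_real (c i (Suc m)) / z ^ Suc m) sums - (\<Sum>j<k. of_real (H $$ (i, j)) * x j)"
      proof -
        have "(\<lambda>m. \<Sum>j<k. of_real (H $$ (i, j)) * (of_real (c j m) / z ^ Suc m)) sums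
            (\<Sum>j<k. of_real (H $$ (i, j)) * x j)"
          unfolding x_def by (intro sums_sum sums_mult summable_sums sm) auto
        from sums_minus[OF this] show ?thesis
          by (simp add: c_Suc[OF i] sum_divide_distrib)
      qed
      ultimately have "z * x i - of_real (c i 0) = - (\<Sum>j<k. of_real (H $$ (i, j)) * x j)"
        by (rule sums_unique2)
      thus ?thesis using c_0[OF i] by (simp add: algebra_simps split: if_splits)
    qed
    define X where "X = Matrix.vec k x"
    have M: "?M \<in> carrier_mat k k" using H by auto
    have MX: "?M *\<^sub>v X = unit_vec k 0"
    proof (rule eq_vecI)
      fix i assume "i < dim_vec (unit_vec k 0 :: complex Matrix.vec)"
      hence i: "i < k" by simp
      have "(?M *\<^sub>v X) $ i = (\<Sum>j<k. ((if i = j then z else 0) + of_real (H $$ (i, j))) * x j)"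
        using i H by (auto simp: X_def scalar_prod_def atLeast0LessThan intro!: sum.cong)
      also have "\<dots> = (\<Sum>j<k. (if i = j then z * x j else 0) + of_real (H $$ (i, j)) * x j)"
        by (intro sum.cong) (auto simp: distrib_right)
      also have "\<dots> = z * x i + (\<Sum>j<k. of_real (H $$ (i, j)) * x j)"
        using i by (simp add: sum.distrib)
      finally show "(?M *\<^sub>v X) $ i = unit_vec k 0 $ i" using Mx[OF i] i by simp
    qed (use H in simp)
    have adj: "adj_mat ?M \<in> carrier_mat k k" "adj_mat ?M * ?M = det ?M \<cdot>\<^sub>m 1\<^sub>m k"
      using adj_mat[OF M] by auto
    have "adj_mat ?M *\<^sub>v unit_vec k 0 = (adj_mat ?M * ?M) *\<^sub>v X"
      unfolding MX[symmetric] by (rule assoc_mult_mat_vec[symmetric]) (use adj M in \<open>auto simp: X_def\<close>)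
    also have "\<dots> = det ?M \<cdot>\<^sub>v X"
      unfolding adj(2) by (intro eq_vecI) (auto simp: X_def)
    finally have "(adj_mat ?M *\<^sub>v unit_vec k 0) $ (k - 1) = det ?M * x (k - 1)"
      using k by (simp add: X_def)
    moreover have "(adj_mat ?M *\<^sub>v unit_vec k 0) $ (k - 1) = cofactor ?M 0 (k - 1)"
    proof -
      have "(adj_mat ?M *\<^sub>v unit_vec k 0) $ (k - 1) = row (adj_mat ?M) (k - 1) \<bullet> unit_vec k 0"
        using k adj(1) by (intro index_mult_mat_vec) auto
      also have "\<dots> = row (adj_mat ?M) (k - 1) $ 0"
        using k adj(1) by (intro scalar_prod_right_unit) auto
      also have "\<dots> = adj_mat ?M $$ (k - 1, 0)"
        using k adj(1) by (intro index_row) auto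
      also have "\<dots> = cofactor ?M 0 (k - 1)"
        unfolding adj_mat_def using k M by (subst index_mat) auto
      finally show ?thesis .
    qed
    moreover have "upper_hessenberg (map_mat complex_of_real H)"
      using hess by (auto simp: upper_hessenberg_def)
    ultimately have "x (k - 1) * (\<Prod>j=1..k. z + \<mu> j)
        = (- 1) ^ (k - 1) * (\<Prod>j<k-1. map_mat complex_of_real H $$ (Suc j, j))"
      using cofactor_hessenberg[of "map_mat complex_of_real H" k z] det_shift_eq_prod[OF H \<mu>, of z] H k
      by (simp add: mult.commute)
    also have "\<dots> = of_real ((- 1) ^ (k - 1) * (\<Prod>j<k-1. H $$ (Suc j, j)))" using H by simp
    finally show "(\<Sum>m. of_real (((- H) ^\<^sub>m m *\<^sub>v unit_vec k 0) $ (k - 1)) / z ^ Suc m) * (\<Prod>j=1..k. z + \<mu> j)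
      = of_real ((- 1) ^ (k - 1) * (\<Prod>j<k-1. H $$ (Suc j, j)))"
      by (simp only: x_def c_def)
  qed
qed

section \<open>Differential inequality for the squared error norm\<close>

lemma energy_estimate:
  fixes E :: "nat \<Rightarrow> real \<Rightarrow> real" and M :: "nat \<Rightarrow> nat \<Rightarrow> real"
  assumes deriv: "\<And>i s. i < n \<Longrightarrow> 0 \<le> s \<Longrightarrow> s \<le> t \<Longrightarrow>
      (E i has_real_derivative - (\<Sum>j<n. M i j * E j s) + g s * w i) (at s)"
    and init: "\<And>i. i < n \<Longrightarrow> E i 0 = 0"
    and w: "(\<Sum>i<n. (w i)\<^sup>2) = 1"
    and coercive: "\<And>x. a * (\<Sum>i<n. (x i)\<^sup>2) \<le> (\<Sum>i<n. x i * (\<Sum>j<n. M i j * x j))"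
    and g: "\<And>s. 0 \<le> s \<Longrightarrow> s \<le> t \<Longrightarrow> \<bar>g s\<bar> \<le> K * exp (\<epsilon> * s)"
    and pos: "0 < \<epsilon> + a" and t: "0 \<le> t"
  shows "(\<Sum>i<n. (E i t)\<^sup>2) \<le> (K * exp (\<epsilon> * t) / (\<epsilon> + a))\<^sup>2"
proof -
  define N where "N = (\<lambda>s. \<Sum>i<n. (E i s)\<^sup>2)"
  \<comment> \<open>\<open>U\<close> is the solution of the equality case \<open>U' = (\<epsilon> - a) U + (\<epsilon> + a) U\<close> of the differential
      inequality for the squared norm \<open>N\<close>; working with squares avoids differentiating the norm at 0.\<close>
  define U where "U = (\<lambda>s. (K / (\<epsilon> + a))\<^sup>2 * exp (2 * \<epsilon> * s))"
  define N' where "N' = (\<lambda>s. \<Sum>i<n. 2 * E i s * (- (\<Sum>j<n. M i j * E j s) + g s * w i))"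
  have dN: "(N has_real_derivative N' s) (at s)" if "0 \<le> s" "s \<le> t" for s
    unfolding N_def N'_def
    by (auto intro!: derivative_eq_intros deriv that sum.cong)
  have dU: "(U has_real_derivative 2 * \<epsilon> * U s) (at s)" for s
    unfolding U_def by (auto intro!: derivative_eq_intros)
  have N'_le: "N' s \<le> (\<epsilon> - a) * N s + (\<epsilon> + a) * U s" if s: "0 \<le> s" "s \<le> t" for s
  proof -
    define S where "S = (\<Sum>i<n. w i * E i s)"
    have "S\<^sup>2 \<le> (\<Sum>i<n. (w i)\<^sup>2) * (\<Sum>i<n. (E i s)\<^sup>2)"
      unfolding S_def by (rule Cauchy_Schwarz_ineq_sum)
    hence S: "S\<^sup>2 \<le> N s" using w by (simp add: N_def)
    have "N' s = 2 * (g s * S) - 2 * (\<Sum>i<n. E i s * (\<Sum>j<n. M i j * E j s))"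
      by (simp add: N'_def S_def algebra_simps sum.distrib sum_subtractf sum_distrib_left)
    also have "\<dots> \<le> 2 * (g s * S) - 2 * (a * N s)"
      using coercive[of "\<lambda>i. E i s"] by (simp add: N_def)
    \<comment> \<open>Young's inequality with weight \<open>\<epsilon> + a\<close>: together with
      \<open>- 2 * a * N s\<close> from coercivity this leaves the coefficient
      \<open>\<epsilon> - a\<close> of \<open>N s\<close>, and the bound on \<open>g\<close> turns
      the other term into \<open>(\<epsilon> + a) * U s\<close>.\<close>
    also have "2 * (g s * S) \<le> (g s)\<^sup>2 / (\<epsilon> + a) + (\<epsilon> + a) * S\<^sup>2"
    proof -
      have "0 \<le> (g s - (\<epsilon> + a) * S)\<^sup>2 / (\<epsilon> + a)" using pos by simp
      also have "\<dots> = (g s)\<^sup>2 / (\<epsilon> + a) + (\<epsilon> + a) * S\<^sup>2 - 2 * (g s * S)"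
      proof -
        have "(x - q * y)\<^sup>2 / q = x\<^sup>2 / q + q * y\<^sup>2 - 2 * (x * y)" if "0 < q" for x y q :: real
          using that by (simp add: field_simps power2_eq_square)
        thus ?thesis using pos .
      qed
      finally show ?thesis by simp
    qed
    also have "(g s)\<^sup>2 \<le> (K * exp (\<epsilon> * s))\<^sup>2"
      using power_mono[OF g[OF s], of 2] by simp
    also have "(K * exp (\<epsilon> * s))\<^sup>2 / (\<epsilon> + a) = (\<epsilon> + a) * U s"
    proof -
      have "(exp (\<epsilon> * s))\<^sup>2 = exp (2 * \<epsilon> * s)"
        by (simp add: power2_eq_square flip: exp_add)
      thus ?thesis using pos by (simp add: U_def power_mult_distrib power_divide power2_eq_square[of "\<epsilon> + a"])
    qed
    also have "(\<epsilon> + a) * S\<^sup>2 \<le> (\<epsilon> + a) * N s" using S pos by simp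
    finally show ?thesis using pos by (simp add: algebra_simps divide_right_mono)
  qed
  \<comment> \<open>The integrating factor of the linear inequality for \<open>N - U\<close>;
    \<open>P\<close> decreases because \<open>U\<close> satisfies with equality the inequality that
    \<open>N\<close> satisfies.\<close>
  define P where "P = (\<lambda>s. exp (- ((\<epsilon> - a) * s)) * (N s - U s))"
  have "P t \<le> P 0"
  proof (rule DERIV_nonpos_imp_nonincreasing[OF t])
    fix s assume s: "0 \<le> s" "s \<le> t"
    let ?y = "exp (- ((\<epsilon> - a) * s)) * (N' s - 2 * \<epsilon> * U s - (\<epsilon> - a) * (N s - U s))"
    have "(P has_real_derivative ?y) (at s)"
      unfolding P_def by (rule derivative_eq_intros dN[OF s] dU refl)+ (simp add: algebra_simps)
    moreover have "?y \<le> 0"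
      using N'_le[OF s] by (intro mult_nonneg_nonpos) (auto simp: algebra_simps)
    ultimately show "\<exists>y. (P has_real_derivative y) (at s) \<and> y \<le> 0" by blast
  qed
  also have "P 0 \<le> 0" by (simp add: P_def N_def U_def init)
  finally have "N t \<le> U t" by (simp add: P_def mult_le_0_iff)
  also have "U t = (K * exp (\<epsilon> * t) / (\<epsilon> + a))\<^sup>2"
  proof -
    have "(exp (\<epsilon> * t))\<^sup>2 = exp (2 * \<epsilon> * t)" by (simp add: power2_eq_square flip: exp_add)
    thus ?thesis by (simp add: U_def power_mult_distrib power_divide)
  qed
  finally show ?thesis by (simp add: N_def)
qed

section \<open>Error and residual of the Arnoldi approximation\<close>

lemma vnorm_eq_sqrt_sum: "x \<in> carrier_vec n \<Longrightarrow> vnorm x = sqrt (\<Sum>i<n. (x $ i)\<^sup>2)"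
  by (auto simp: vnorm_def scalar_prod_def atLeast0LessThan power2_eq_square)

lemma vnorm_pos:
  assumes "v \<in> carrier_vec n" "v \<noteq> 0\<^sub>v n" shows "0 < vnorm v"
proof -
  obtain i where i: "i < n" "v $ i \<noteq> 0" using assms by (metis eq_vecI carrier_vecD index_zero_vec)
  hence "0 < (\<Sum>i<n. (v $ i)\<^sup>2)" by (intro sum_pos2[of _ i]) auto
  thus ?thesis using vnorm_eq_sqrt_sum[OF assms(1)] by simp
qed

text \<open>Derivatives at 0 of the last entry of \<open>exp (-s H) e_1\<close>; the overview's
  \<open>g\<close> is \<open>egf (delay l (krylov_tail k H))\<close>.\<close>

definition krylov_tail :: "nat \<Rightarrow> real mat \<Rightarrow> nat \<Rightarrow> real" where
  "krylov_tail k H m = ((- H) ^\<^sub>m m *\<^sub>v unit_vec k 0) $ (k - 1)"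

text \<open>For \<open>u = \<beta> e_1\<close>, the delayed generating function of these
  coefficients is component \<open>i\<close> of \<open>s ^ l\<close> times the Arnoldi
  approximation.\<close>

definition krylov_approx :: "real mat \<Rightarrow> real mat \<Rightarrow> real Matrix.vec \<Rightarrow> nat \<Rightarrow> nat \<Rightarrow> real" where
  "krylov_approx V H u i m = (V *\<^sub>v ((- H) ^\<^sub>m m *\<^sub>v u)) $ i"

lemma neg_smult_mat: "(- t) \<cdot>\<^sub>m M = t \<cdot>\<^sub>m (- M)" for M :: "real mat"
  by (intro eq_matI) auto

lemma exp_type_krylov_tail: "H \<in> carrier_mat k k \<Longrightarrow> 1 \<le> k \<Longrightarrow> exp_type (krylov_tail k H)"
  unfolding krylov_tail_def[abs_def] by (intro exp_type_pow_mat_vec) auto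

lemma egf_delay_lincomb:
  assumes q: "\<And>j. j \<in> J \<Longrightarrow> exp_type (q j)" and r: "exp_type r"
  shows "egf (delay l (\<lambda>m. (\<Sum>j\<in>J. a j * q j m) + b * r m)) s
    = (\<Sum>j\<in>J. a j * egf (delay l (q j)) s) + b * egf (delay l r) s"
proof -
  have q': "exp_type (\<lambda>N. a j * delay l (q j) N)" if "j \<in> J" for j
    by (intro exp_type_cmult exp_type_delay q that)
  have "egf (delay l (\<lambda>m. (\<Sum>j\<in>J. a j * q j m) + b * r m)) s
      = egf (\<lambda>N. \<Sum>j\<in>J. a j * delay l (q j) N) s + egf (\<lambda>N. b * delay l r N) s"
    unfolding delay_add delay_sum delay_cmult
    by (intro egf_add exp_type_sum exp_type_cmult exp_type_delay q r)
  also have "egf (\<lambda>N. \<Sum>j\<in>J. a j * delay l (q j) N) s = (\<Sum>j\<in>J. egf (\<lambda>N. a j * delay l (q j) N) s)"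
    by (rule egf_sum[OF q'])
  also have "\<dots> = (\<Sum>j\<in>J. a j * egf (delay l (q j)) s)"
    by (intro sum.cong refl egf_cmult exp_type_delay q)
  also have "egf (\<lambda>N. b * delay l r N) s = b * egf (delay l r) s"
    by (intro egf_cmult exp_type_delay r)
  finally show ?thesis .
qed

lemma egf_at_0: "egf c 0 = c 0"
  unfolding egf_def by (subst powser_zero) simp

lemma phi_mat_last_entry:
  assumes H: "H \<in> carrier_mat k k" and k: "1 \<le> k"
  shows "t ^ l * (unit_vec k (k - 1) \<bullet> (phi_mat l ((- t) \<cdot>\<^sub>m H) *\<^sub>v unit_vec k 0))
    = egf (delay l (krylov_tail k H)) t"
proof -
  have nH: "- H \<in> carrier_mat k k" using H by simp
  have P: "phi_mat l ((- t) \<cdot>\<^sub>m H) \<in> carrier_mat k k" using H by (intro phi_mat_carrier) simp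
  hence "phi_mat l ((- t) \<cdot>\<^sub>m H) *\<^sub>v unit_vec k 0 \<in> carrier_vec k"
    by (rule mult_mat_vec_carrier) simp
  hence "unit_vec k (k - 1) \<bullet> (phi_mat l ((- t) \<cdot>\<^sub>m H) *\<^sub>v unit_vec k 0)
      = (phi_mat l ((- t) \<cdot>\<^sub>m H) *\<^sub>v unit_vec k 0) $ (k - 1)"
    using k by (intro scalar_prod_left_unit) auto
  moreover have "t ^ l * (phi_mat l (t \<cdot>\<^sub>m (- H)) *\<^sub>v unit_vec k 0) $ (k - 1) = egf (delay l (krylov_tail k H)) t"
    unfolding krylov_tail_def[abs_def] using k by (intro phi_mat_vec_index[OF nH]) auto
  ultimately show ?thesis by (simp add: neg_smult_mat)
qed

lemma krylov_approx_eq_sum: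
  assumes "V \<in> carrier_mat n k" "H \<in> carrier_mat k k" "u \<in> carrier_vec k" "i < n"
  shows "krylov_approx V H u i m = (\<Sum>j<k. V $$ (i, j) * ((- H) ^\<^sub>m m *\<^sub>v u) $ j)"
proof -
  have "(- H) ^\<^sub>m m *\<^sub>v u \<in> carrier_vec k"
    using assms pow_carrier_mat[of "- H" k m] by (intro mult_mat_vec_carrier) auto
  thus ?thesis using assms
    by (simp add: krylov_approx_def scalar_prod_def atLeast0LessThan del: index_mult_mat_vec)
       (simp add: scalar_prod_def atLeast0LessThan)
qed

lemma exp_type_krylov_approx:
  assumes "V \<in> carrier_mat n k" "H \<in> carrier_mat k k" "u \<in> carrier_vec k" "i < n"
  shows "exp_type (krylov_approx V H u i)"
proof -
  have "krylov_approx V H u i = (\<lambda>m. \<Sum>j<k. V $$ (i, j) * ((- H) ^\<^sub>m m *\<^sub>v u) $ j)"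
    using krylov_approx_eq_sum[OF assms] by auto
  thus ?thesis using assms
    by (simp only:) (intro exp_type_sum exp_type_cmult exp_type_pow_mat_vec[where n = k], auto)
qed

lemma arnoldi_approx_index:
  assumes V: "V \<in> carrier_mat n k" and H: "H \<in> carrier_mat k k" and i: "i < n"
  shows "s ^ l * arnoldi_approx l V H v s $ i
    = egf (delay l (krylov_approx V H (vnorm v \<cdot>\<^sub>v unit_vec k 0) i)) s"
proof -
  let ?u = "vnorm v \<cdot>\<^sub>v unit_vec k 0"
  have nH: "- H \<in> carrier_mat k k" using H by simp
  have e: "exp_type (\<lambda>m. ((- H) ^\<^sub>m m *\<^sub>v ?u) $ j)" if "j < k" for j
    by (rule exp_type_pow_mat_vec[OF nH _ that]) simp
  define y where "y = phi_mat l (s \<cdot>\<^sub>m (- H)) *\<^sub>v ?u"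
  have "phi_mat l (s \<cdot>\<^sub>m (- H)) \<in> carrier_mat k k" using H by (intro phi_mat_carrier) simp
  hence y: "y \<in> carrier_vec k" unfolding y_def by (rule mult_mat_vec_carrier) simp
  have "s ^ l * arnoldi_approx l V H v s $ i = s ^ l * (\<Sum>j<k. V $$ (i, j) * y $ j)"
    using V H y i by (simp add: arnoldi_approx_def neg_smult_mat y_def[symmetric] scalar_prod_def atLeast0LessThan)
  also have "\<dots> = (\<Sum>j<k. V $$ (i, j) * (s ^ l * y $ j))" by (simp add: sum_distrib_left mult_ac)
  also have "\<dots> = (\<Sum>j<k. V $$ (i, j) * egf (delay l (\<lambda>m. ((- H) ^\<^sub>m m *\<^sub>v ?u) $ j)) s)"
    unfolding y_def by (intro sum.cong refl arg_cong2[of _ _ _ _ "(*)"] phi_mat_vec_index[OF nH]) auto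
  also have "\<dots> = egf (delay l (\<lambda>m. \<Sum>j<k. V $$ (i, j) * ((- H) ^\<^sub>m m *\<^sub>v ?u) $ j)) s"
    using egf_delay_lincomb[OF e exp_type_zero, where J = "{..<k}" and a = "\<lambda>j. V $$ (i, j)" and b = 0] by simp
  also have "(\<lambda>m. \<Sum>j<k. V $$ (i, j) * ((- H) ^\<^sub>m m *\<^sub>v ?u) $ j) = krylov_approx V H ?u i"
    using krylov_approx_eq_sum[OF V H _ i, of ?u] by auto
  finally show ?thesis .
qed

lemma krylov_approx_0:
  assumes arn: "arnoldi n k A v V w H h" and A: "A \<in> carrier_mat n n" and k: "1 \<le> k"
    and v: "v \<in> carrier_vec n" "v \<noteq> 0\<^sub>v n" and i: "i < n"
  shows "krylov_approx V H (vnorm v \<cdot>\<^sub>v unit_vec k 0) i 0 = v $ i"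
proof -
  note car = arnoldi_carrier[OF arn A k]
  have "krylov_approx V H (vnorm v \<cdot>\<^sub>v unit_vec k 0) i 0 = (V *\<^sub>v (vnorm v \<cdot>\<^sub>v unit_vec k 0)) $ i"
    using car by (simp add: krylov_approx_def)
  also have "\<dots> = vnorm v * col V 0 $ i"
    using car i k by (simp add: scalar_prod_right_unit[of 0 k])
  also have "\<dots> = v $ i"
    unfolding arnoldi_col_0[OF arn A k] using v i vnorm_pos[OF v] by simp
  finally show ?thesis .
qed

text \<open>The Arnoldi relation applied to the \<open>m\<close>-th Krylov vector of
  \<open>- H\<close> trades \<open>V H\<close> for \<open>A V\<close> at the cost of a multiple of
  \<open>w\<close>. This defect is what separates the recurrence from that of
  \<open>(- A) ^ m v\<close>, and it drives both residual and error.\<close>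

lemma krylov_approx_Suc:
  assumes arn: "arnoldi n k A v V w H h" and A: "A \<in> carrier_mat n n" and k: "1 \<le> k" and i: "i < n"
  shows "krylov_approx V H (\<beta> \<cdot>\<^sub>v unit_vec k 0) i (Suc m)
    = - (\<Sum>j<n. A $$ (i, j) * krylov_approx V H (\<beta> \<cdot>\<^sub>v unit_vec k 0) j m) + h * \<beta> * w $ i * krylov_tail k H m"
proof -
  note car = arnoldi_carrier[OF arn A k]
  let ?u = "\<beta> \<cdot>\<^sub>v unit_vec k 0 :: real Matrix.vec"
  have nH: "- H \<in> carrier_mat k k" using car by simp
  have Hm: "(- H) ^\<^sub>m m \<in> carrier_mat k k" by (rule pow_carrier_mat[OF nH])
  define p where "p = (- H) ^\<^sub>m m *\<^sub>v ?u"
  have p: "p \<in> carrier_vec k" unfolding p_def using Hm by (rule mult_mat_vec_carrier) simp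
  have pk: "p $ (k - 1) = \<beta> * krylov_tail k H m"
    unfolding p_def krylov_tail_def using Hm k by (subst mult_mat_vec) auto
  have Vp: "V *\<^sub>v p \<in> carrier_vec n" "V *\<^sub>v (H *\<^sub>v p) \<in> carrier_vec n" using car p by auto
  have "(- H) ^\<^sub>m Suc m *\<^sub>v ?u = - H *\<^sub>v p"
    unfolding p_def by (rule pow_mat_vec_Suc[OF nH]) simp
  also have "\<dots> = - (H *\<^sub>v p)" using car p by simp
  finally have "V *\<^sub>v ((- H) ^\<^sub>m Suc m *\<^sub>v ?u) = V *\<^sub>v ((- 1) \<cdot>\<^sub>v (H *\<^sub>v p))"
    by (simp add: uminus_vec_def smult_vec_def)
  also have "\<dots> = (- 1) \<cdot>\<^sub>v (V *\<^sub>v (H *\<^sub>v p))" using car p by (intro mult_mat_vec) auto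
  finally have 1: "krylov_approx V H ?u i (Suc m) = - (V *\<^sub>v (H *\<^sub>v p)) $ i"
    unfolding krylov_approx_def using car i by simp
  have "A *\<^sub>v (V *\<^sub>v p) = V *\<^sub>v (H *\<^sub>v p) + (h * p $ (k - 1)) \<cdot>\<^sub>v w"
    using arnoldi_relation[OF arn A k] by (intro Arnoldi_relation_vec[OF A car(1,3,2) k p]) auto
  hence "(A *\<^sub>v (V *\<^sub>v p)) $ i = (V *\<^sub>v (H *\<^sub>v p)) $ i + h * p $ (k - 1) * w $ i"
    using car i Vp by (simp del: index_mult_mat_vec)
  moreover have "(A *\<^sub>v (V *\<^sub>v p)) $ i = (\<Sum>j<n. A $$ (i, j) * (V *\<^sub>v p) $ j)"
  proof -
    have "(A *\<^sub>v x) $ i = (\<Sum>j<n. A $$ (i, j) * x $ j)" if "x \<in> carrier_vec n" for x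
      using A i that by (simp add: scalar_prod_def atLeast0LessThan)
    thus ?thesis using Vp(1) by blast
  qed
  ultimately have "(\<Sum>j<n. A $$ (i, j) * (V *\<^sub>v p) $ j) = (V *\<^sub>v (H *\<^sub>v p)) $ i + h * (\<beta> * krylov_tail k H m) * w $ i"
    by (simp only: pk)
  moreover have "krylov_approx V H ?u j m = (V *\<^sub>v p) $ j" for j
    by (simp only: krylov_approx_def p_def)
  ultimately show ?thesis unfolding 1 by simp
qed

text \<open>For \<open>Y s = s ^ l * y s\<close> the recurrence gives \<open>Y' = - A Y\<close> plus
  the source in \<open>v\<close> and the defect along \<open>w\<close>. Returning to
  \<open>y\<close>, the quotient rule creates the term \<open>- (l / t) y\<close>, and in the
  residual all but the defect cancels.\<close>

lemma residual_eq:
  assumes arn: "arnoldi n k A v V w H h" and A: "A \<in> carrier_mat n n" and k: "1 \<le> k"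
    and v: "v \<in> carrier_vec n" "v \<noteq> 0\<^sub>v n" and t: "0 < t"
  shows "residual l A v (arnoldi_approx l V H v) t
    = (- (h * vnorm v * egf (delay l (krylov_tail k H)) t / t ^ l)) \<cdot>\<^sub>v w"
proof -
  note car = arnoldi_carrier[OF arn A k]
  define u where "u = vnorm v \<cdot>\<^sub>v unit_vec k 0"
  have u: "u \<in> carrier_vec k" by (simp add: u_def)
  define q where "q = krylov_approx V H u"
  define Y where "Y = (\<lambda>i. egf (delay l (q i)))"
  define y where "y = arnoldi_approx l V H v"
  define G where "G = egf (delay l (krylov_tail k H))"
  have yc: "y s \<in> carrier_vec n" for s using car by (intro carrier_vecI) (simp add: y_def arnoldi_approx_def)
  have q: "exp_type (q i)" if "i < n" for i unfolding q_def by (rule exp_type_krylov_approx[OF car(1,3) u that])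
  have yY: "s ^ l * y s $ i = Y i s" if "i < n" for i s
    using arnoldi_approx_index[OF car(1,3) that, of s l v] by (simp add: y_def Y_def q_def u_def)
  have Y': "(Y i has_real_derivative
      (if l = 0 then 0 else v $ i * t ^ (l - 1) / fact (l - 1))
      + (- (\<Sum>j<n. A $$ (i, j) * Y j t) + h * vnorm v * w $ i * G t)) (at t)" if i: "i < n" for i
  proof -
    have "q i 0 = v $ i" unfolding q_def u_def by (rule krylov_approx_0[OF arn A k v i])
    moreover have "(\<lambda>m. q i (Suc m))
        = (\<lambda>m. (\<Sum>j<n. - A $$ (i, j) * q j m) + h * vnorm v * w $ i * krylov_tail k H m)"
      unfolding q_def u_def by (simp only: krylov_approx_Suc[OF arn A k i] sum_negf mult_minus_left)
    moreover have "egf (delay l (\<lambda>m. (\<Sum>j<n. - A $$ (i, j) * q j m) + h * vnorm v * w $ i * krylov_tail k H m)) t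
        = (\<Sum>j<n. - A $$ (i, j) * Y j t) + h * vnorm v * w $ i * G t"
      unfolding Y_def G_def by (rule egf_delay_lincomb[OF q exp_type_krylov_tail[OF car(3) k]]) simp
    ultimately show ?thesis using DERIV_egf_delay[OF q[OF i], of l t]
      by (cases "l = 0") (simp_all add: Y_def sum_negf)
  qed
  have dy: "deriv (\<lambda>s. y s $ i) t = ((if l = 0 then 0 else v $ i * t ^ (l - 1) / fact (l - 1))
      + (- (\<Sum>j<n. A $$ (i, j) * Y j t) + h * vnorm v * w $ i * G t)) / t ^ l - real l / t * y t $ i"
    (is "_ = ?D / t ^ l - _") if i: "i < n" for i
  proof (rule DERIV_imp_deriv)
    have "((\<lambda>s. Y i s / s ^ l) has_real_derivative ?D / t ^ l - real l / t * (Y i t / t ^ l)) (at t)"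
    proof (rule DERIV_cong[OF DERIV_divide[OF Y'[OF i] DERIV_pow]])
      have "(D * t ^ l - y * (real l * t ^ (l - Suc 0))) / (t ^ l * t ^ l) = D / t ^ l - real l / t * (y / t ^ l)" for D y
        using t by (cases l) (auto simp: field_simps)
      thus "(?D * t ^ l - Y i t * (real l * t ^ (l - Suc 0))) / (t ^ l * t ^ l)
        = ?D / t ^ l - real l / t * (Y i t / t ^ l)" .
    qed (use t in simp)
    moreover have "Y i t / t ^ l = y t $ i" using yY[OF i, of t, symmetric] t by simp
    ultimately have "((\<lambda>s. Y i s / s ^ l) has_real_derivative ?D / t ^ l - real l / t * y t $ i) (at t)" by simp
    \<comment> \<open>Division by \<open>s ^ l\<close> is safe away from 0, so the functions are
      identified on the open half-line containing \<open>t\<close>.\<close>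
    thus "((\<lambda>s. y s $ i) has_real_derivative ?D / t ^ l - real l / t * y t $ i) (at t)"
    proof (rule has_field_derivative_transform_within_open)
      show "Y i s / s ^ l = y s $ i" if "s \<in> {0<..}" for s
        using yY[OF i, of s, symmetric] that by simp
    qed (use t in auto)
  qed
  have Ay: "(A *\<^sub>v y t) $ i = (\<Sum>j<n. A $$ (i, j) * Y j t) / t ^ l" if i: "i < n" for i
  proof -
    have "(A *\<^sub>v y t) $ i = (\<Sum>j<n. A $$ (i, j) * y t $ j)"
      using A i yc[of t] by (simp add: scalar_prod_def atLeast0LessThan)
    also have "\<dots> = (\<Sum>j<n. A $$ (i, j) * Y j t / t ^ l)"
      using t by (intro sum.cong refl) (simp add: yY[symmetric])
    finally show ?thesis by (simp add: sum_divide_distrib)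
  qed
  show ?thesis unfolding y_def[symmetric] G_def[symmetric]
  proof (rule eq_vecI)
    fix i assume "i < dim_vec ((- (h * vnorm v * G t / t ^ l)) \<cdot>\<^sub>v w)"
    hence i: "i < n" using car by simp
    have vd: "vec_deriv y t $ i = deriv (\<lambda>s. y s $ i) t" using yc[of t] i by (simp add: vec_deriv_def)
    have dims: "dim_vec (A *\<^sub>v y t) = n" "dim_vec (y t) = n" "dim_vec (vec_deriv y t) = n" "dim_vec v = n"
      using A yc[of t] v by (auto simp: vec_deriv_def)
    show "residual l A v y t $ i = ((- (h * vnorm v * G t / t ^ l)) \<cdot>\<^sub>v w) $ i"
    proof (cases "l = 0")
      case True
      have "residual l A v y t $ i = - (A *\<^sub>v y t) $ i - vec_deriv y t $ i"
        using True i dims by (simp add: residual_def del: index_mult_mat_vec)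
      thus ?thesis using True i car by (simp add: vd dy Ay del: index_mult_mat_vec)
    next
      case False
      have "residual l A v y t $ i = - (A *\<^sub>v y t) $ i - real l / t * y t $ i + 1 / (t * fact (l - 1)) * v $ i - vec_deriv y t $ i"
        using False i dims by (simp add: residual_def del: index_mult_mat_vec)
      moreover have "t ^ l = t * t ^ (l - 1)" using False by (simp add: power_eq_if)
      ultimately show ?thesis using False i car t
        by (simp add: vd dy Ay add_divide_distrib diff_divide_distrib del: index_mult_mat_vec)
    qed
  qed (use A car in \<open>auto simp: residual_def vec_deriv_def arnoldi_approx_def y_def\<close>)
qed

section \<open>Error estimate and conclusion\<close>

lemma vnorm_smult: "vnorm (c \<cdot>\<^sub>v x) = \<bar>c\<bar> * vnorm x"
proof -
  have "vnorm (c \<cdot>\<^sub>v x) = sqrt (c\<^sup>2 * (x \<bullet> x))"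
    by (simp add: vnorm_def power2_eq_square mult.assoc)
  thus ?thesis by (simp add: vnorm_def real_sqrt_mult)
qed

lemma arnoldi_error_le:
  assumes arn: "arnoldi n k A v V w H h" and A: "A \<in> carrier_mat n n" and k: "1 \<le> k"
    and v: "v \<in> carrier_vec n" "v \<noteq> 0\<^sub>v n" and t: "0 < t"
    and W: "numerical_range (map_mat complex_of_real A) \<subseteq> sector \<theta> a" and \<theta>: "\<theta> \<le> pi / 2"
    and g: "\<And>s. 0 \<le> s \<Longrightarrow> s \<le> t \<Longrightarrow> \<bar>egf (delay l (krylov_tail k H)) s\<bar> \<le> K * exp (\<epsilon> * s)"
    and pos: "0 < \<epsilon> + a"
  shows "t ^ l * vnorm (exact_solution l A v t - arnoldi_approx l V H v t)
    \<le> \<bar>h\<bar> * vnorm v * K * exp (\<epsilon> * t) / (\<epsilon> + a)"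
proof -
  note car = arnoldi_carrier[OF arn A k]
  define u where "u = vnorm v \<cdot>\<^sub>v unit_vec k 0"
  have u: "u \<in> carrier_vec k" by (simp add: u_def)
  have nA: "- A \<in> carrier_mat n n" using A by simp
  \<comment> \<open>Coefficients of the error. Exact solution and approximation both start from
    \<open>v\<close>, so \<open>d i 0 = 0\<close> and the source term of
    \<open>DERIV_egf_delay\<close> disappears from the equation for \<open>E\<close>.\<close>
  define d where "d = (\<lambda>i m. ((- A) ^\<^sub>m m *\<^sub>v v) $ i + (- 1) * krylov_approx V H u i m)"
  define E where "E = (\<lambda>i. egf (delay l (d i)))"
  define G where "G = egf (delay l (krylov_tail k H))"
  have x1: "exp_type (\<lambda>m. ((- A) ^\<^sub>m m *\<^sub>v v) $ i)" "exp_type (krylov_approx V H u i)" if "i < n" for i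
    using exp_type_krylov_approx[OF car(1,3) u that] exp_type_pow_mat_vec[OF nA v(1) that] by auto
  hence d: "exp_type (d i)" if "i < n" for i
    unfolding d_def by (intro exp_type_add exp_type_cmult x1 that)
  have err: "t ^ l * (exact_solution l A v t - arnoldi_approx l V H v t) $ i = E i t" if i: "i < n" for i
  proof -
    have "(exact_solution l A v t - arnoldi_approx l V H v t) $ i
        = (phi_mat l (t \<cdot>\<^sub>m (- A)) *\<^sub>v v) $ i - arnoldi_approx l V H v t $ i"
      using car i by (simp add: exact_solution_def arnoldi_approx_def neg_smult_mat)
    hence "t ^ l * (exact_solution l A v t - arnoldi_approx l V H v t) $ i
        = egf (delay l (\<lambda>m. ((- A) ^\<^sub>m m *\<^sub>v v) $ i)) t - egf (delay l (krylov_approx V H u i)) t"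
      using phi_mat_vec_index[OF nA v(1) i, of t l] arnoldi_approx_index[OF car(1,3) i, of t l v]
      by (simp add: u_def right_diff_distrib)
    also have "\<dots> = E i t"
      unfolding E_def d_def delay_add delay_cmult
      using egf_add[OF exp_type_delay[OF x1(1)[OF i]] exp_type_cmult[OF exp_type_delay[OF x1(2)[OF i]]], of l "- 1" l]
        egf_cmult[OF exp_type_delay[OF x1(2)[OF i]], of "- 1" l] by simp
    finally show ?thesis .
  qed
  have d0: "d i 0 = 0" if "i < n" for i
    using krylov_approx_0[OF arn A k v that] that A v by (simp add: d_def u_def)
  have E': "(E i has_real_derivative - (\<Sum>j<n. A $$ (i, j) * E j s) + (- (h * vnorm v * G s)) * w $ i) (at s)"
    if i: "i < n" for i s
  proof -
    have dS: "(\<lambda>m. d i (Suc m))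
        = (\<lambda>m. (\<Sum>j<n. - A $$ (i, j) * d j m) + (- (h * vnorm v * w $ i)) * krylov_tail k H m)"
      unfolding d_def u_def uminus_pow_mat_vec_Suc_index[OF A v(1) i] krylov_approx_Suc[OF arn A k i]
      by (simp add: algebra_simps sum.distrib sum_negf sum_subtractf)
    have "egf (delay l (\<lambda>m. d i (Suc m))) s
        = (\<Sum>j<n. - A $$ (i, j) * E j s) + (- (h * vnorm v * w $ i)) * G s"
      unfolding dS E_def G_def by (rule egf_delay_lincomb[OF d exp_type_krylov_tail[OF car(3) k]]) simp
    thus ?thesis using DERIV_egf_delay[OF d[OF i], of l s] d0[OF i]
      by (cases "l = 0") (simp_all add: E_def sum_negf mult_ac)
  qed
  have "(\<Sum>i<n. (E i t)\<^sup>2) \<le> (\<bar>h\<bar> * vnorm v * K * exp (\<epsilon> * t) / (\<epsilon> + a))\<^sup>2"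
  proof (rule energy_estimate[where w = "\<lambda>i. w $ i" and g = "\<lambda>s. - (h * vnorm v * G s)", OF E'])
    \<comment> \<open>For \<open>l > 0\<close> the delay itself gives 0; for \<open>l = 0\<close>
      the value is \<open>d i 0\<close>.\<close>
    show "E i 0 = 0" if "i < n" for i
      using d0[OF that] by (simp add: E_def egf_at_0 delay_def)
    show "(\<Sum>i<n. (w $ i)\<^sup>2) = 1"
      using arnoldi_orthonormal(2)[OF arn A k] car
      by (simp add: scalar_prod_def atLeast0LessThan power2_eq_square)
    show "a * (\<Sum>i<n. (x i)\<^sup>2) \<le> (\<Sum>i<n. x i * (\<Sum>j<n. A $$ (i, j) * x j))" for x
      by (rule numerical_range_coercive[OF A W \<theta>])
    show "\<bar>- (h * vnorm v * G s)\<bar> \<le> \<bar>h\<bar> * vnorm v * K * exp (\<epsilon> * s)" if "0 \<le> s" "s \<le> t" for s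
      using g[OF that] vnorm_pos[OF v] by (simp add: G_def abs_mult mult_left_mono mult.assoc)
  qed (use pos t in auto)
  hence "sqrt (\<Sum>i<n. (E i t)\<^sup>2) \<le> \<bar>\<bar>h\<bar> * vnorm v * K * exp (\<epsilon> * t) / (\<epsilon> + a)\<bar>"
    by (metis real_sqrt_abs real_sqrt_le_iff)
  moreover have "0 \<le> K" using g[of 0] t by simp
  moreover have "t ^ l * vnorm (exact_solution l A v t - arnoldi_approx l V H v t) = sqrt (\<Sum>i<n. (E i t)\<^sup>2)"
  proof -
    let ?e = "exact_solution l A v t - arnoldi_approx l V H v t"
    have e: "dim_vec ?e = n" using car by (simp add: arnoldi_approx_def)
    hence "t ^ l \<cdot>\<^sub>v ?e \<in> carrier_vec n" by (intro carrier_vecI) simp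
    hence "vnorm (t ^ l \<cdot>\<^sub>v ?e) = sqrt (\<Sum>i<n. ((t ^ l \<cdot>\<^sub>v ?e) $ i)\<^sup>2)" by (intro vnorm_eq_sqrt_sum)
    also have "\<dots> = sqrt (\<Sum>i<n. (E i t)\<^sup>2)"
      using e by (intro arg_cong[of _ _ sqrt] sum.cong refl) (simp add: err[symmetric] del: index_minus_vec)
    finally show ?thesis using t by (simp add: vnorm_smult)
  qed
  ultimately show ?thesis using vnorm_pos[OF v] pos by simp
qed

text \<open>The eigenvalues of \<open>H\<close> lie in the numerical range, hence in
  \<open>Re z \<ge> a \<ge> 0\<close>, so all poles are left of the line. Nonnegative subdiagonal
  entries make the absolute value of the numerator their plain product.\<close>

lemma krylov_tail_bound:
  assumes arn: "arnoldi n k A v V w H h" and A: "A \<in> carrier_mat n n" and k: "1 \<le> k"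
    and W: "numerical_range (map_mat complex_of_real A) \<subseteq> sector \<theta> a" and \<theta>: "\<theta> \<le> pi / 2" and a: "0 \<le> a"
    and \<mu>: "eigenvalue_enum H k k1 \<mu>" and \<epsilon>: "0 < \<epsilon>" and decay: "4 \<le> k + k1 + 2 * l" and s: "0 \<le> s"
  shows "\<bar>egf (delay l (krylov_tail k H)) s\<bar>
    \<le> (\<Prod>j<k-1. H $$ (Suc j, j)) * (LBINT x:{0..}. bound_weight l k k1 \<mu> \<epsilon> x) / (pi * omega k \<mu> \<epsilon> * \<epsilon> ^ l)
      * exp (\<epsilon> * s)"
proof -
  note car = arnoldi_carrier[OF arn A k]
  have re: "0 \<le> Re (\<mu> j)" if "j \<in> {1..k}" for j
    using arnoldi_eigenvalue_in_numerical_range[OF arn A k eigenvalue_enum_eigenvalue[OF car(3) \<mu> that]]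
      W Re_ge_of_sector[OF _ \<theta>] a by (meson order_trans subsetD)
  have k1: "k1 \<le> k" using \<mu> by (simp add: eigenvalue_enum_def)
  let ?p = "(- 1) ^ (k - 1) * (\<Prod>j<k-1. H $$ (Suc j, j))"
  let ?I = "LBINT x:{0..}. bound_weight l k k1 \<mu> \<epsilon> x"
  have abs_p: "\<bar>?p\<bar> = (\<Prod>j<k-1. H $$ (Suc j, j))"
    using prod_nonneg[of "{..<k-1}" "\<lambda>j. H $$ (Suc j, j)"] arnoldi_hessenberg(2)[OF arn A k]
    by (simp add: abs_mult power_abs)
  obtain r0 where r0: "\<And>z. r0 < norm z \<Longrightarrow>
    (\<Sum>m. of_real (krylov_tail k H m) / z ^ Suc m) * (\<Prod>j=1..k. z + \<mu> j) = of_real ?p"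
    by (rule resolvent_entry[OF car(3) arnoldi_hessenberg(1)[OF arn A k] k \<mu>, folded krylov_tail_def]) (rule that)
  have "2 * pi * \<bar>egf (delay l (krylov_tail k H)) s\<bar>
      \<le> exp (s * \<epsilon>) * \<bar>?p\<bar> * (2 * ?I / (omega k \<mu> \<epsilon> * \<epsilon> ^ l))"
    \<comment> \<open>The required \<open>2 \<le> k + l\<close> holds because
      \<open>k1 \<le> k\<close> turns \<open>decay\<close> into
      \<open>4 \<le> 2 * k + 2 * l\<close>.\<close>
    using k1 decay
    by (intro Bromwich_bound[OF exp_type_krylov_tail[OF car(3) k] re \<epsilon> s _ r0]
          integral_resolvent_le[OF car(3) \<mu> re \<epsilon> decay]) auto
  hence "\<bar>egf (delay l (krylov_tail k H)) s\<bar>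
      \<le> exp (s * \<epsilon>) * \<bar>?p\<bar> * (2 * ?I / (omega k \<mu> \<epsilon> * \<epsilon> ^ l)) / (2 * pi)"
    by (subst pos_le_divide_eq) (auto simp: mult_ac)
  thus ?thesis unfolding abs_p by (simp add: mult_ac)
qed

theorem theorem4p2:
  fixes A V H :: "real mat" and v w :: "real Matrix.vec" and n k k1 l :: nat
    and h t \<epsilon> a \<theta> :: real and \<mu> :: "nat \<Rightarrow> complex"
  assumes "A \<in> carrier_mat n n"
    and "v \<in> carrier_vec n" and "v \<noteq> 0\<^sub>v n"
    and "k \<ge> 1" and "t > 0"
    and "a \<ge> 0" and "0 \<le> \<theta>" and "\<theta> \<le> pi / 2"
    and "numerical_range (map_mat complex_of_real A) \<subseteq> sector \<theta> a"
    and "arnoldi n k A v V w H h"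
    and "unit_vec k (k - 1) \<bullet> (phi_mat l ((- t) \<cdot>\<^sub>m H) *\<^sub>v unit_vec k 0) \<noteq> 0"
    and "eigenvalue_enum H k k1 \<mu>"
    and "\<epsilon> > 0"
    and "k + k1 + 2 * l \<ge> 4"
  shows "vnorm (exact_solution l A v t - arnoldi_approx l V H v t)
    \<le> bound_const l k H \<mu> a \<epsilon> t
      * (LBINT \<rho>:{0..}. (1 + \<rho>\<^sup>2 / \<epsilon>\<^sup>2) powr (- real l / 2) / varsigma k k1 \<mu> \<epsilon> \<rho>)
      * vnorm (residual l A v (arnoldi_approx l V H v) t)"
proof -
  note A = assms(1) and v = assms(2,3) and k = assms(4) and t = assms(5) and arn = assms(10)
  note car = arnoldi_carrier[OF arn A k]
  define f where "f = unit_vec k (k - 1) \<bullet> (phi_mat l ((- t) \<cdot>\<^sub>m H) *\<^sub>v unit_vec k 0)"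
  define I where "I = (LBINT x:{0..}. bound_weight l k k1 \<mu> \<epsilon> x)"
  define P where "P = (\<Prod>j<k-1. H $$ (Suc j, j))"
  define K where "K = P * I / (pi * omega k \<mu> \<epsilon> * \<epsilon> ^ l)"
  have f: "f \<noteq> 0" "egf (delay l (krylov_tail k H)) t = t ^ l * f"
    using assms(11) phi_mat_last_entry[OF car(3) k, of t l] by (auto simp: f_def)
  have "vnorm w = 1" using arnoldi_orthonormal(2)[OF arn A k] by (simp add: vnorm_def)
  hence res: "vnorm (residual l A v (arnoldi_approx l V H v) t) = \<bar>h\<bar> * vnorm v * \<bar>f\<bar>"
    unfolding residual_eq[OF arn A k v t] vnorm_smult f(2) using t vnorm_pos[OF v]
    by (simp add: abs_mult)
  have "t ^ l * vnorm (exact_solution l A v t - arnoldi_approx l V H v t)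
      \<le> \<bar>h\<bar> * vnorm v * K * exp (\<epsilon> * t) / (\<epsilon> + a)"
    unfolding K_def P_def I_def
    using arnoldi_error_le[OF arn A k v t assms(9,8) krylov_tail_bound[OF arn A k assms(9,8,6,12,13,14)]]
      assms(6,13) by simp
  hence "vnorm (exact_solution l A v t - arnoldi_approx l V H v t)
      \<le> \<bar>h\<bar> * vnorm v * K * exp (\<epsilon> * t) / (\<epsilon> + a) / t ^ l"
    using t by (subst pos_le_divide_eq) (auto simp: mult.commute)
  \<comment> \<open>The factor \<open>\<bar>h\<bar> * vnorm v\<close> is shared with the residual
    norm; completing it to that norm inserts \<open>\<bar>f\<bar>\<close> in numerator and
    denominator, which needs \<open>f \<noteq> 0\<close>.\<close>
  also have "\<dots> = (exp (t * \<epsilon>) / (pi * (t * \<epsilon>) ^ l * omega k \<mu> \<epsilon> * (\<epsilon> + a)) * (P / \<bar>f\<bar>)) * I * (\<bar>h\<bar> * vnorm v * \<bar>f\<bar>)"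
    using f(1) by (simp add: K_def power_mult_distrib mult_ac)
  finally show ?thesis
    unfolding res bound_const_def f_def[symmetric] P_def[symmetric] I_def bound_weight_def .
qed

end
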